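(* Let $R$ be as in the standing setup and suppose the $m$-adic filtration of $R$ satisfies the BF condition. Then the associated graded ring $\operatorname{gr}(R)=\bigoplus_{i\ge0}m^i/m^{i+1}$ is Cohen–Macaulay if and only if $a_j=b_j$ for all $j=0,\ldots,e-1$.
   Context: Standing setup: $k$ is a field and $R$ is a complete local domain with $k\subseteq R\subseteq k[[t]]$, residue field $k$, maximal ideal $m$, and nonzero conductor $(R:k[[t]])\neq 0$. Let $v$ be the $t$-adic valuation, $S=v(R)=\{v(r): r\in R, r\neq 0\}$, $e$ the smallest positive element of $S$, and $w_j$ the smallest element of $S$ congruent to $j\pmod e$. For a nonzero ideal $I$, $v(I)=\{v(a): a\in I, a\ne0\}$; $m^0=R$. Set $b_j=\max\{i: w_j\in v(m^i)\}$. Let $R'=\bigcup_{n\ge0}(m^n:m^n)$ be the blowup of $R$; let $w'_j$ be the smallest element of $v(R')$ congruent to $j\pmod e$, and define $a_j$ by $w'_j=w_j-a_je$. The $m$-adic filtration satisfies the BF condition if there exist $x\in R$ with $v(x)=e$ and $f_0,\ldots,f_{e-1}\in R$ with $v(f_j)=w_j$ such that for every $i\ge0$, $m^i$ is a free $k[[x]]$-module with a basis of the form $x^{h_0}f_0,\ldots,x^{h_{e-1}}f_{e-1}$ for some nonnegative integers $h_j$ (depending on $i$). *)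

theory Defs
  imports "HOL-Computational_Algebra.Formal_Power_Series" "HOL-Algebra.Ring_Divisibility"
    "HOL-Algebra.Ideal" "HOL-Library.Extended_Nat"
begin

text \<open>The maximal ideal of R: since R is local with residue field k and k is contained in R,
  the maximal ideal is the set of elements of R with zero constant term.\<close>
definition mideal :: "'a::field fps set \<Rightarrow> 'a fps set" where
  "mideal R = {r \<in> R. fps_nth r 0 = 0}"

inductive_set ideal_prod :: "'a::comm_ring_1 set \<Rightarrow> 'a set \<Rightarrow> 'a set" for A B where
  zero: "0 \<in> ideal_prod A B"
| step: "a \<in> A \<Longrightarrow> b \<in> B \<Longrightarrow> x \<in> ideal_prod A B \<Longrightarrow> a * b + x \<in> ideal_prod A B"

fun mpow :: "'a::field fps set \<Rightarrow> nat \<Rightarrow> 'a fps set" where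
  "mpow R 0 = R"
| "mpow R (Suc i) = ideal_prod (mpow R i) (mideal R)"

definition valset :: "'a::field fps set \<Rightarrow> nat set" where
  "valset I = subdegree ` (I - {0})"

definition mult_e :: "'a::field fps set \<Rightarrow> nat" where
  "mult_e R = (LEAST n. 0 < n \<and> n \<in> valset R)"

definition w_elt :: "'a::field fps set \<Rightarrow> nat \<Rightarrow> nat" where
  "w_elt R j = (LEAST n. n \<in> valset R \<and> n mod mult_e R = j mod mult_e R)"

definition b_idx :: "'a::field fps set \<Rightarrow> nat \<Rightarrow> nat" where
  "b_idx R j = (GREATEST i. w_elt R j \<in> valset (mpow R i))"

text \<open>The blowup R' = union of the (m^n : m^n). These colon rings lie between R and its
  integral closure k[[t]], so they are taken inside k[[t]].\<close>
definition blowup :: "'a::field fps set \<Rightarrow> 'a fps set" where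
  "blowup R = {f. \<exists>n. \<forall>y \<in> mpow R n. f * y \<in> mpow R n}"

definition w'_elt :: "'a::field fps set \<Rightarrow> nat \<Rightarrow> nat" where
  "w'_elt R j = (LEAST n. n \<in> valset (blowup R) \<and> n mod mult_e R = j mod mult_e R)"

text \<open>a_j defined by w'_j = w_j - a_j e.\<close>
definition a_idx :: "'a::field fps set \<Rightarrow> nat \<Rightarrow> nat" where
  "a_idx R j = (w_elt R j - w'_elt R j) div mult_e R"

text \<open>BF condition: each m^i is a free k[[x]]-module with basis x^{h_j} f_j, j < e.
  Elements of k[[x]] are the compositions g(x) = g oo x with g in k[[t]].\<close>
definition BF_condition :: "'a::field fps set \<Rightarrow> bool" where
  "BF_condition R \<longleftrightarrow>
    (\<exists>x f. x \<in> R \<and> x \<noteq> 0 \<and> subdegree x = mult_e R \<and>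
      (\<forall>j < mult_e R. f j \<in> R \<and> f j \<noteq> 0 \<and> subdegree (f j) = w_elt R j) \<and>
      (\<forall>i. \<exists>h :: nat \<Rightarrow> nat.
         mpow R i = {(\<Sum>j < mult_e R. fps_compose (g j) x * x ^ h j * f j) | g. True} \<and>
         (\<forall>g. (\<Sum>j < mult_e R. fps_compose (g j) x * x ^ h j * f j) = 0
               \<longrightarrow> (\<forall>j < mult_e R. g j = 0))))"

definition grcoset :: "'a::field fps set \<Rightarrow> nat \<Rightarrow> 'a fps \<Rightarrow> 'a fps set" where
  "grcoset R i a = {a + y | y. y \<in> mpow R (Suc i)}"

definition gr_carrier :: "'a::field fps set \<Rightarrow> (nat \<Rightarrow> 'a fps set) set" where
  "gr_carrier R = {c. (\<forall>i. \<exists>a \<in> mpow R i. c i = grcoset R i a)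
                      \<and> finite {i. c i \<noteq> mpow R (Suc i)}}"

definition grrep :: "'a::field fps set \<Rightarrow> (nat \<Rightarrow> 'a fps set) \<Rightarrow> nat \<Rightarrow> 'a fps" where
  "grrep R c i = (SOME a. a \<in> mpow R i \<and> c i = grcoset R i a)"

definition gr_ring :: "'a::field fps set \<Rightarrow> (nat \<Rightarrow> 'a fps set) ring" where
  "gr_ring R = \<lparr> carrier = gr_carrier R,
     monoid.mult = (\<lambda>c d n. grcoset R n (\<Sum>i\<le>n. grrep R c i * grrep R d (n - i))),
     one = (\<lambda>n. grcoset R n (if n = 0 then 1 else 0)),
     zero = (\<lambda>n. grcoset R n 0),
     add = (\<lambda>c d n. grcoset R n (grrep R c n + grrep R d n)) \<rparr>"

definition regular_seq :: "('b, 'c) ring_scheme \<Rightarrow> 'b set \<Rightarrow> 'b list \<Rightarrow> bool" where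
  "regular_seq A I xs \<longleftrightarrow> set xs \<subseteq> I \<and> genideal A (set xs) \<noteq> carrier A \<and>
     (\<forall>i < length xs. \<forall>y \<in> carrier A.
        xs ! i \<otimes>\<^bsub>A\<^esub> y \<in> genideal A (set (take i xs)) \<longrightarrow> y \<in> genideal A (set (take i xs)))"

definition grade :: "('b, 'c) ring_scheme \<Rightarrow> 'b set \<Rightarrow> enat" where
  "grade A I = Sup ((\<lambda>xs. enat (length xs)) ` {xs. regular_seq A I xs})"

definition height :: "('b, 'c) ring_scheme \<Rightarrow> 'b set \<Rightarrow> enat" where
  "height A P = Sup {enat n | n. \<exists>Q :: nat \<Rightarrow> 'b set.
      (\<forall>i \<le> n. primeideal (Q i) A) \<and> (\<forall>i < n. Q i \<subset> Q (Suc i)) \<and> Q n = P}"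

text \<open>A Noetherian commutative ring is Cohen--Macaulay iff for every maximal ideal n the
  localization at n is Cohen--Macaulay, i.e. depth A_n = grade(n, A) equals dim A_n = height n.\<close>
definition cohen_macaulay :: "('b, 'c) ring_scheme \<Rightarrow> bool" where
  "cohen_macaulay A \<longleftrightarrow> cring A \<and> noetherian_ring A \<and>
     (\<forall>n. maximalideal n A \<longrightarrow> grade A n = height A n)"

end

theory Submission
  imports Defs "HOL-Computational_Algebra.Polynomial"
begin

text \<open>The initial form \<open>x\<^sup>*\<close> of \<open>x\<close> in degree one generates an ideal of \<open>gr(R)\<close> containing a power of the irrelevant
  maximal ideal, and \<open>gr(R)\<close> modulo its nilradical is a polynomial ring in one variable over \<open>k\<close>: send the class of
  \<open>a \<in> m\<^sup>i\<close> to the coefficient of \<open>t\<^sup>i\<^sup>e\<close> in \<open>a\<close>. Hence all maximal ideals have height one and grade at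
  most one, and \<open>gr(R)\<close> is Cohen--Macaulay iff \<open>x\<^sup>*\<close> is a nonzerodivisor. Under the BF condition
  \<open>m\<^sup>i\<close> is spanned by \<open>x\<^bsup>h(i,j)\<^esup> f\<^sub>j\<close>, where \<open>h(0,j) = 0\<close> and \<open>h(i,j)\<close> grows by \<open>0\<close> or \<open>1\<close> in each step.
  Here \<open>b\<^sub>j\<close> is the number of zero steps before the first unit step and \<open>a\<^sub>j\<close> the total number of zero
  steps, while \<open>x\<^sup>*\<close> is a nonzerodivisor iff no unit step is followed by a zero step.\<close>

section \<open>Rings with a polynomial ring as reduction\<close>

text \<open>\<open>cohen_macaulay\<close> ranges over all maximal ideals of gr(R), while the initial
  form of x lives in the irrelevant one. The passage uses the polynomial reduction: every maximal
  ideal contains a polynomial in that initial form with coefficients in k, and comparing lowest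
  terms shows it to be a nonzerodivisor once the initial form is. In the other direction, a power of
  any nonzerodivisor in the irrelevant ideal is a multiple of the initial form, because m^(i+1) = x
  m^i for large i. The grade is a supremum over arbitrary regular sequences and the Noetherian
  property belongs to the definition, so both are treated by hand: lengths are bounded through the
  nil kernel, finite generation comes from a filtration with small steps. Elements of gr(R) are
  families of cosets multiplied through chosen representatives; all computation is therefore moved
  to the Rees ring. The conductor yields a single constant c with t^(ie+c) k[[t]] inside m^i for
  every i; nilpotency of the kernel and the uniform length bound both rest on it.\<close>

locale poly_quotient = cring A for A (structure) +
  fixes \<phi> :: "'a \<Rightarrow> 'k::field poly"
  assumes phi_add: "\<lbrakk>a \<in> carrier A; b \<in> carrier A\<rbrakk> \<Longrightarrow> \<phi> (a \<oplus> b) = \<phi> a + \<phi> b"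
    and phi_mult: "\<lbrakk>a \<in> carrier A; b \<in> carrier A\<rbrakk> \<Longrightarrow> \<phi> (a \<otimes> b) = \<phi> a * \<phi> b"
    and phi_one: "\<phi> \<one> = 1"
    and phi_surj: "\<exists>a \<in> carrier A. \<phi> a = p"
    and phi_nilpotent: "\<lbrakk>a \<in> carrier A; \<phi> a = 0\<rbrakk> \<Longrightarrow> \<exists>n::nat. a [^] n = \<zero>"
begin

lemma phi_zero: "\<phi> \<zero> = 0"
proof -
  have "\<phi> \<zero> + \<phi> \<zero> = \<phi> \<zero> + 0" using phi_add[of \<zero> \<zero>] by simp
  then show ?thesis by (simp only: add_left_cancel)
qed

lemma phi_uminus: "a \<in> carrier A \<Longrightarrow> \<phi> (\<ominus> a) = - \<phi> a"
  using phi_add[of a "\<ominus> a"] by (simp add: r_neg phi_zero eq_neg_iff_add_eq_0 add.commute)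

lemma phi_minus: "\<lbrakk>a \<in> carrier A; b \<in> carrier A\<rbrakk> \<Longrightarrow> \<phi> (a \<ominus> b) = \<phi> a - \<phi> b"
  by (simp add: a_minus_def phi_add phi_uminus)

lemma phi_pow: "a \<in> carrier A \<Longrightarrow> \<phi> (a [^] (n::nat)) = \<phi> a ^ n"
  by (induction n) (simp_all add: phi_one phi_mult)

text \<open>Taking \<open>g = 0\<close> gives the kernel of \<open>\<phi>\<close>, taking
  \<open>g = X\<close> the irrelevant ideal of gr(R). Writing the kernel as
  \<open>0 dvd \<phi> a\<close> lets one ideal proof serve both.\<close>

lemma ideal_dvd: "ideal {a \<in> carrier A. g dvd \<phi> a} A"
proof (rule idealI)
  show "subgroup {a \<in> carrier A. g dvd \<phi> a} (add_monoid A)"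
    by (rule group.subgroupI[OF a_group])
      (auto simp: phi_add phi_uminus a_inv_def[symmetric] phi_zero intro: exI[of _ \<zero>])
qed (auto simp: phi_mult ring_axioms)

section \<open>Prime and maximal ideals, and their heights\<close>

lemma pow_mem_primeideal:
  assumes "primeideal P A" "a \<in> carrier A" "a [^] (n::nat) \<in> P"
  shows "a \<in> P"
proof -
  interpret P: primeideal P A by fact
  from assms(3) show ?thesis
  proof (induction n)
    case 0
    then show ?case using P.one_imp_carrier P.I_notcarr by simp
  next
    case (Suc n)
    then show ?case using P.I_prime[of "a [^] n" a] assms(2) by auto
  qed
qed

lemma kernel_subset_primeideal:
  assumes "primeideal P A"
  shows "{a \<in> carrier A. 0 dvd \<phi> a} \<subseteq> P"
proof safe
  fix a assume a: "a \<in> carrier A" "0 dvd \<phi> a"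
  then obtain n :: nat where n: "a [^] n = \<zero>" using phi_nilpotent by auto
  have "\<zero> \<in> P"
    by (rule additive_subgroup.zero_closed[OF ideal.axioms(1)[OF primeideal.axioms(1)[OF assms]]])
  then show "a \<in> P" using pow_mem_primeideal[OF assms a(1), of n] n by simp
qed

lemma primeideal_kernel: "primeideal {a \<in> carrier A. 0 dvd \<phi> a} A"
proof (rule primeidealI[OF ideal_dvd cring_axioms])
  have "\<one> \<notin> {a \<in> carrier A. 0 dvd \<phi> a}" by (simp add: phi_one)
  then show "carrier A \<noteq> {a \<in> carrier A. 0 dvd \<phi> a}" by blast
qed (auto simp: phi_mult)

text \<open>Euclidean division in k[X]: quotients lift along \<open>\<phi>\<close>, and the
  remainder is again the image of a member of \<open>P\<close>, so an image of least degree divides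
  all others.\<close>

lemma ideal_generator:
  assumes "ideal P A" "a0 \<in> P" "\<phi> a0 \<noteq> 0"
  obtains g where "g \<in> P" "\<phi> g \<noteq> 0" "\<And>a. a \<in> P \<Longrightarrow> \<phi> g dvd \<phi> a"
proof -
  interpret P: ideal P A by fact
  obtain g where g: "g \<in> P" "\<phi> g \<noteq> 0"
    and least: "\<And>a. a \<in> P \<Longrightarrow> \<phi> a \<noteq> 0 \<Longrightarrow> degree (\<phi> g) \<le> degree (\<phi> a)"
    using ex_has_least_nat[of "\<lambda>a. a \<in> P \<and> \<phi> a \<noteq> 0" a0 "\<lambda>a. degree (\<phi> a)"] assms by blast
  have "\<phi> g dvd \<phi> a" if a: "a \<in> P" for a
  proof (rule ccontr)
    assume nd: "\<not> \<phi> g dvd \<phi> a"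
    obtain q where q: "q \<in> carrier A" "\<phi> q = \<phi> a div \<phi> g" using phi_surj by blast
    let ?r = "a \<ominus> g \<otimes> q"
    have cg: "g \<in> carrier A" and ca: "a \<in> carrier A" using a g P.Icarr by auto
    have rP: "?r \<in> P" unfolding a_minus_def
      using P.I_r_closed[OF g(1) q(1)] a by simp
    have "\<phi> ?r = \<phi> a mod \<phi> g"
      using ca cg q by (simp add: phi_minus phi_mult minus_mult_div_eq_mod)
    moreover have "\<phi> a mod \<phi> g \<noteq> 0" using nd by (simp add: dvd_eq_mod_eq_0)
    ultimately show False
      using least[OF rP] degree_mod_less'[OF g(2), of "\<phi> a"] by simp
  qed
  with g that show thesis by blast
qed

text \<open>k[X] is not a field: an ideal inside the kernel is strictly contained in the proper
  preimage of (X).\<close>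

lemma maximalideal_not_in_kernel:
  assumes "maximalideal M A"
  shows "\<exists>a \<in> M. \<phi> a \<noteq> 0"
proof (rule ccontr)
  assume neg: "\<not> ?thesis"
  interpret M: maximalideal M A by fact
  let ?X = "[:0, 1::'k:]"
  let ?J = "{a \<in> carrier A. ?X dvd \<phi> a}"
  have "M \<subseteq> ?J" using neg M.Icarr by auto
  then have "?J = M \<or> ?J = carrier A" using M.I_maximal[OF ideal_dvd] by blast
  moreover obtain x where "x \<in> carrier A" "\<phi> x = ?X" using phi_surj by blast
  then have "x \<in> ?J" "x \<notin> M" using neg by auto
  moreover have "\<one> \<notin> ?J"
    by (simp add: phi_one is_unit_iff_degree)
  ultimately show False by blast
qed

text \<open>Evaluation at 0 identifies the quotient with k: outside the ideal the constant term
  \<open>c\<close> is nonzero, and removing the rest and dividing by \<open>c\<close> gives 1 up to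
  the kernel.\<close>

lemma maximalideal_dvd_X: "maximalideal {a \<in> carrier A. [:0, 1:] dvd \<phi> a} A"
proof (rule maximalidealI[OF ideal_dvd])
  let ?X = "[:0, 1::'k:]"
  let ?N = "{a \<in> carrier A. ?X dvd \<phi> a}"
  have one: "\<one> \<notin> ?N" by (simp add: phi_one is_unit_iff_degree)
  then show "carrier A \<noteq> ?N" using one_closed by blast
  fix J assume J: "ideal J A" "?N \<subseteq> J" "J \<subseteq> carrier A"
  interpret J: ideal J A by fact
  show "J = ?N \<or> J = carrier A"
  proof (cases "J = ?N")
    case False
    then obtain z where z: "z \<in> J" "z \<notin> ?N" using J(2) by blast
    then have zc: "z \<in> carrier A" and nd: "\<not> ?X dvd \<phi> z" using J(3) by auto
    define c where "c = poly (\<phi> z) 0"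
    have c: "c \<noteq> 0" using nd by (simp add: c_def poly_eq_0_iff_dvd)
    obtain w where w: "w \<in> carrier A" "\<phi> w = \<phi> z - [:c:]" using phi_surj by blast
    obtain u where u: "u \<in> carrier A" "\<phi> u = [:inverse c:]" using phi_surj by blast
    have "poly (\<phi> w) 0 = 0" by (simp add: w c_def)
    then have "w \<in> ?N" using w(1) by (simp add: poly_eq_0_iff_dvd)
    then have "w \<in> J" using J(2) by blast
    then have zwu: "(z \<ominus> w) \<otimes> u \<in> J"
      using z(1) u(1) J.I_r_closed[of "z \<ominus> w" u] by (simp add: a_minus_def)
    have "\<phi> (\<one> \<ominus> (z \<ominus> w) \<otimes> u) = 0"
      using zc w u c by (simp add: phi_minus phi_mult phi_one)
    then have "\<one> \<ominus> (z \<ominus> w) \<otimes> u \<in> ?N" using zc w(1) u(1) by simp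
    then have "\<one> \<ominus> (z \<ominus> w) \<otimes> u \<in> J" using J(2) by blast
    then have "(\<one> \<ominus> (z \<ominus> w) \<otimes> u) \<oplus> (z \<ominus> w) \<otimes> u \<in> J" using zwu by simp
    then have "\<one> \<in> J" using zc w(1) u(1) by (simp add: a_minus_def a_assoc l_neg)
    then show ?thesis using J.one_imp_carrier by blast
  qed (rule disjI1)
qed

text \<open>Nonzero primes of k[X] are maximal. The generator of \<open>N\<close> divides that of
  \<open>Q\<close>, say \<open>\<phi> g = \<phi> d * \<phi> q\<close>; by primality \<open>d\<close>
  or \<open>q\<close> lies in \<open>Q\<close>, and then \<open>N\<close> is contained in
  \<open>Q\<close> or \<open>d\<close> maps to a unit.\<close>

lemma primeideal_chain_bound:
  assumes "primeideal P A" "primeideal Q A" "primeideal N A" "P \<subset> Q" "Q \<subset> N"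
  shows False
proof -
  interpret P: primeideal P A by fact
  interpret Q: primeideal Q A by fact
  interpret N: primeideal N A by fact
  obtain z where z: "z \<in> Q" "z \<notin> P" using assms by blast
  then have z0: "\<phi> z \<noteq> 0"
    using subsetD[OF kernel_subset_primeideal[OF assms(1)], of z] Q.Icarr[OF z(1)] by auto
  obtain g where g: "g \<in> Q" "\<phi> g \<noteq> 0" "\<And>a. a \<in> Q \<Longrightarrow> \<phi> g dvd \<phi> a"
    using ideal_generator[OF Q.is_ideal z(1) z0] by blast
  obtain d where d: "d \<in> N" "\<phi> d \<noteq> 0" "\<And>a. a \<in> N \<Longrightarrow> \<phi> d dvd \<phi> a"
    using ideal_generator[OF N.is_ideal _ z0] z assms(5) by blast
  \<comment> \<open>Primes contain the kernel, so membership can be decided on images.\<close>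
  have mem: "a \<in> I" if I: "primeideal I A" "s \<in> I" and a: "a \<in> carrier A" "\<phi> s dvd \<phi> a" for I s a
  proof -
    interpret I: primeideal I A by fact
    from a obtain q' where "\<phi> a = \<phi> s * q'" by (elim dvdE)
    with phi_surj[of q'] obtain q where q: "q \<in> carrier A" "\<phi> a = \<phi> s * \<phi> q" by blast
    have "a \<ominus> s \<otimes> q \<in> I"
      using kernel_subset_primeideal[OF I(1)] a q I.Icarr[OF I(2)]
      by (force simp: phi_minus phi_mult)
    then have "(a \<ominus> s \<otimes> q) \<oplus> s \<otimes> q \<in> I"
      using I.I_r_closed[OF I(2) q(1)] by simp
    then show ?thesis using a q I.Icarr[OF I(2)]
      by (simp add: a_minus_def a_assoc l_neg)
  qed
  have "\<phi> d dvd \<phi> g" using d(3)[of g] g assms(5) by blast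
  then obtain q' where "\<phi> g = \<phi> d * q'" by (elim dvdE)
  with phi_surj[of q'] obtain q where q: "q \<in> carrier A" "\<phi> g = \<phi> d * \<phi> q" by blast
  have dc: "d \<in> carrier A" using N.Icarr d by blast
  have "d \<otimes> q \<in> Q" using mem[OF assms(2) g(1)] q dc by (simp add: phi_mult)
  then consider "d \<in> Q" | "q \<in> Q" using Q.I_prime[OF dc q(1)] by blast
  then show False
  proof cases
    case 1
    have "N \<subseteq> Q"
    proof
      fix a assume "a \<in> N"
      then show "a \<in> Q" using mem[OF assms(2) 1] d(3) N.Icarr by blast
    qed
    then show False using assms(5) by blast
  next
    case 2
    then have "\<phi> d * \<phi> q dvd \<phi> q" using g(3) q by metis
    then have "\<phi> d dvd 1" using g(2) q(2)
      by (metis dvd_mult_cancel_right mult_1 mult_zero_right)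
    then have "\<one> \<in> N" using mem[OF assms(3) d(1)] by (simp add: phi_one)
    then show False using N.one_imp_carrier N.I_notcarr by blast
  qed
qed

lemma height_maximalideal:
  assumes "maximalideal M A"
  shows "height A M = 1"
proof -
  have prime: "primeideal M A" by (rule maximalideal_prime[OF assms])
  let ?S = "{enat n | n. \<exists>Q :: nat \<Rightarrow> 'a set.
      (\<forall>i \<le> n. primeideal (Q i) A) \<and> (\<forall>i < n. Q i \<subset> Q (Suc i)) \<and> Q n = M}"
  let ?K = "{a \<in> carrier A. 0 dvd \<phi> a}"
  have KM: "?K \<subset> M"
    using kernel_subset_primeideal[OF prime] maximalideal_not_in_kernel[OF assms] by auto
  have "enat 1 \<in> ?S"
    by (rule CollectI, rule exI[of _ 1], rule conjI[OF refl],
        rule exI[of _ "\<lambda>i::nat. if i = 0 then ?K else M"])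
      (use prime primeideal_kernel KM in simp)
  moreover have "s \<le> enat 1" if sS: "s \<in> ?S" for s
  proof -
    obtain n and Q :: "nat \<Rightarrow> 'a set" where n: "s = enat n" "\<forall>i \<le> n. primeideal (Q i) A"
      "\<forall>i < n. Q i \<subset> Q (Suc i)" using sS by auto
    have "n < 2"
    proof (rule ccontr)
      assume "\<not> n < 2"
      then show False
        using primeideal_chain_bound[of "Q 0" "Q 1" "Q (Suc 1)"] n(2,3) by auto
    qed
    then show ?thesis using n by simp
  qed
  ultimately have "Sup ?S = enat 1" by (intro antisym Sup_least Sup_upper)
  then show ?thesis by (simp add: height_def one_enat_def)
qed

section \<open>Regular sequences and the grade of a maximal ideal\<close>

lemma genideal_empty: "genideal A {} = {\<zero>}"
  using genideal_minimal[OF zeroideal, of "{}"]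
    additive_subgroup.zero_closed[OF ideal.axioms(1)[OF genideal_ideal[of "{}"]]]
  by auto

text \<open>With \<open>\<phi> M = (g)\<close> and \<open>\<phi> z = g\<^sup>a p\<close>, \<open>g\<close> not dividing \<open>p\<close>, the element \<open>w\<^sup>a P - z Q\<close> lies in the
  kernel of \<open>\<phi>\<close> for suitable lifts \<open>P\<close> of \<open>p\<close> and \<open>Q\<close>. Since it is nilpotent and \<open>w\<close> is regular
  modulo \<open>z\<close>, some power of \<open>P\<close> is a multiple of \<open>z\<close>, so that \<open>g\<close> divides \<open>p\<close>.\<close>
lemma no_regular_pair:
  assumes M: "maximalideal M A" and z: "z \<in> M" and w: "w \<in> M"
    and zreg: "\<And>y. y \<in> carrier A \<Longrightarrow> z \<otimes> y = \<zero> \<Longrightarrow> y = \<zero>"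
    and wreg: "\<And>y. y \<in> carrier A \<Longrightarrow> w \<otimes> y \<in> genideal A {z} \<Longrightarrow> y \<in> genideal A {z}"
  shows False
proof -
  interpret M: maximalideal M A by fact
  interpret P: primeideal M A by (rule maximalideal_prime[OF M])
  have zc: "z \<in> carrier A" and wc: "w \<in> carrier A" using z w M.Icarr by auto
  have one_nz: "\<one> \<noteq> \<zero>" using phi_one phi_zero by auto
  \<comment> \<open>A regular element is not nilpotent, so \<open>\<phi> z\<close> is nonzero and
    contains the factor \<open>\<phi> g\<close> only finitely often.\<close>
  have pow_reg: "z [^] (n::nat) \<noteq> \<zero>" for n
  proof (induction n)
    case (Suc n)
    then show ?case using zreg[of "z [^] n"] zc by (auto simp: m_comm)
  qed (use one_nz in simp)
  have z0: "\<phi> z \<noteq> 0" using phi_nilpotent[OF zc] pow_reg by auto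
  obtain g where g: "g \<in> M" "\<phi> g \<noteq> 0" "\<And>a. a \<in> M \<Longrightarrow> \<phi> g dvd \<phi> a"
    using ideal_generator[OF M.is_ideal z z0] by blast
  have gc: "g \<in> carrier A" using g M.Icarr by blast
  have gnu: "\<not> \<phi> g dvd 1"
  proof
    assume "\<phi> g dvd 1"
    then obtain u' where "1 = \<phi> g * u'" by (elim dvdE)
    with phi_surj[of u'] obtain u where u: "u \<in> carrier A" "1 = \<phi> g * \<phi> u" by blast
    have "\<one> \<ominus> g \<otimes> u \<in> M"
      using kernel_subset_primeideal[OF P.primeideal] u gc
      by (force simp: phi_minus phi_mult phi_one)
    then have "(\<one> \<ominus> g \<otimes> u) \<oplus> g \<otimes> u \<in> M" using M.I_r_closed[OF g(1) u(1)] by simp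
    then have "\<one> \<in> M" using gc u by (simp add: a_minus_def a_assoc l_neg)
    then show False using M.one_imp_carrier M.I_notcarr by blast
  qed
  have dg: "degree (\<phi> g) > 0" using gnu g(2) is_unit_iff_degree by blast
  have bound: "n \<le> degree (\<phi> z)" if n: "\<phi> g ^ n dvd \<phi> z" for n
  proof -
    have "n * degree (\<phi> g) \<le> degree (\<phi> z)"
      using dvd_imp_degree_le[OF n z0] g(2) by (simp add: degree_power_eq)
    moreover have "n \<le> n * degree (\<phi> g)" using dg by simp
    ultimately show ?thesis by linarith
  qed
  define a where "a = (GREATEST n. \<phi> g ^ n dvd \<phi> z)"
  have a: "\<phi> g ^ a dvd \<phi> z" unfolding a_def
    by (rule GreatestI_nat[where k=0 and b="degree (\<phi> z)"]) (use bound in auto)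
  have a_max: "\<not> \<phi> g ^ Suc a dvd \<phi> z"
  proof
    assume "\<phi> g ^ Suc a dvd \<phi> z"
    then have "Suc a \<le> a" unfolding a_def using bound
      by (intro Greatest_le_nat) auto
    then show False by simp
  qed
  from a obtain p' where "\<phi> z = \<phi> g ^ a * p'" by (elim dvdE)
  with phi_surj[of p'] obtain p where p: "p \<in> carrier A" "\<phi> z = \<phi> g ^ a * \<phi> p" by blast
  have gp: "\<not> \<phi> g dvd \<phi> p" using a_max p(2) g(2) by simp
  then have pM: "p \<notin> M" using g(3) by blast
  have "\<phi> g dvd \<phi> w" using g(3) w by blast
  then have "\<phi> g ^ a dvd \<phi> w ^ a" by (rule dvd_power_same)
  then obtain q' where "\<phi> w ^ a = \<phi> g ^ a * q'" by (elim dvdE)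
  with phi_surj[of q'] obtain q where q: "q \<in> carrier A" "\<phi> w ^ a = \<phi> g ^ a * \<phi> q" by blast
  let ?s = "w [^] a \<otimes> p" and ?t = "z \<otimes> q"
  have c: "?s \<in> carrier A" "?t \<in> carrier A" using wc zc p q by auto
  have "\<phi> (?s \<ominus> ?t) = 0"
    using c wc zc p(1) q(1) by (simp add: phi_minus phi_mult phi_pow p(2) q(2))
  then obtain n :: nat where n: "(?s \<ominus> ?t) [^] n = \<zero>"
    using phi_nilpotent c by blast
  interpret Z: ideal "genideal A {z}" A by (rule genideal_ideal) (use zc in simp)
  have zZ: "z \<in> genideal A {z}" by (rule genideal_self') (use zc in simp)
  have tZ: "?t \<in> genideal A {z}" using Z.I_r_closed[OF zZ q(1)] .
  have "?s [^] m \<ominus> (?s \<ominus> ?t) [^] m \<in> genideal A {z}" for m :: nat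
  proof (induction m)
    case 0
    then show ?case by (simp add: a_minus_def r_neg)
  next
    case (Suc m)
    let ?u = "(?s \<ominus> ?t) [^] m"
    have uc: "?u \<in> carrier A" and smc: "?s [^] m \<in> carrier A" using c by auto
    have "?s [^] Suc m \<ominus> (?s \<ominus> ?t) [^] Suc m = (?s [^] m \<ominus> ?u) \<otimes> ?s \<oplus> ?u \<otimes> ?t"
      using c uc smc unfolding nat_pow_Suc by algebra
    also have "\<dots> \<in> genideal A {z}"
      using Z.I_r_closed[OF Suc c(1)] Z.I_l_closed[OF tZ uc] by simp
    finally show ?case .
  qed
  from this[of n] have "?s [^] n \<in> genideal A {z}" using n c by (simp add: a_minus_def)
  moreover have "?s [^] n = w [^] (a * n) \<otimes> p [^] n"
    using wc p by (simp add: nat_pow_distrib nat_pow_pow)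
  moreover have "y \<in> genideal A {z}"
    if "w [^] (m::nat) \<otimes> y \<in> genideal A {z}" "y \<in> carrier A" for m y using that
  proof (induction m arbitrary: y)
    case (Suc m)
    have "w [^] m \<otimes> (w \<otimes> y) \<in> genideal A {z}"
      using Suc.prems wc by (simp add: m_assoc)
    then have "w \<otimes> y \<in> genideal A {z}" using Suc.IH Suc.prems(2) wc by simp
    then show ?case using wreg Suc.prems(2) by blast
  qed simp
  ultimately have "p [^] n \<in> genideal A {z}" using p by auto
  also have "\<dots> \<subseteq> M" by (rule genideal_minimal[OF M.is_ideal]) (use z in simp)
  finally show False using pow_mem_primeideal[OF P.primeideal p(1)] pM by blast
qed

lemma regular_seq_length_le:
  assumes "maximalideal M A" "regular_seq A M xs"
  shows "length xs \<le> 1"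
proof (rule ccontr)
  assume "\<not> length xs \<le> 1"
  then obtain z w xs' where xs: "xs = z # w # xs'"
    by (metis One_nat_def Suc_le_mono le0 length_Cons list.exhaust list.size(3))
  have zw: "z \<in> M" "w \<in> M" using assms(2) by (auto simp: regular_seq_def xs)
  have r: "\<And>i y. i < length xs \<Longrightarrow> y \<in> carrier A \<Longrightarrow> xs ! i \<otimes> y \<in> genideal A (set (take i xs))
      \<Longrightarrow> y \<in> genideal A (set (take i xs))"
    using assms(2) unfolding regular_seq_def by blast
  show False
    by (rule no_regular_pair[OF assms(1) zw])
      (use r[of 0] r[of 1] in \<open>auto simp: xs genideal_empty\<close>)
qed

text \<open>Lengths are at most one, so only the existence of a one-term sequence matters; the ideal
  it generates is proper because it lies in \<open>M\<close>.\<close>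

lemma grade_maximalideal_eq_1_iff:
  assumes M: "maximalideal M A"
  shows "grade A M = 1 \<longleftrightarrow> (\<exists>z \<in> M. \<forall>y \<in> carrier A. z \<otimes> y = \<zero> \<longrightarrow> y = \<zero>)"
proof
  assume g: "grade A M = 1"
  have "\<exists>xs. regular_seq A M xs \<and> 0 < length xs"
  proof (rule ccontr)
    assume "\<not> ?thesis"
    then have "grade A M \<le> 0"
      unfolding grade_def by (intro Sup_least) (auto simp: zero_enat_def)
    then show False using g by simp
  qed
  then obtain z xs where reg: "regular_seq A M (z # xs)" by (metis length_greater_0_conv list.exhaust)
  then have "z \<in> M" by (simp add: regular_seq_def)
  moreover have "\<forall>y \<in> carrier A. z \<otimes> y = \<zero> \<longrightarrow> y = \<zero>"
    using reg unfolding regular_seq_def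
    by (auto simp: genideal_empty dest!: spec[of _ 0])
  ultimately show "\<exists>z \<in> M. \<forall>y \<in> carrier A. z \<otimes> y = \<zero> \<longrightarrow> y = \<zero>" by blast
next
  assume "\<exists>z \<in> M. \<forall>y \<in> carrier A. z \<otimes> y = \<zero> \<longrightarrow> y = \<zero>"
  then obtain z where z: "z \<in> M" "\<forall>y \<in> carrier A. z \<otimes> y = \<zero> \<longrightarrow> y = \<zero>" by blast
  interpret M: maximalideal M A by fact
  have "genideal A {z} \<subseteq> M" by (rule genideal_minimal[OF M.is_ideal]) (use z in simp)
  then have "genideal A {z} \<noteq> carrier A" using M.I_notcarr M.a_subset by blast
  then have "regular_seq A M [z]" using z by (auto simp: regular_seq_def genideal_empty)
  then have "enat 1 \<le> grade A M" unfolding grade_def by (intro Sup_upper) (auto simp: image_iff)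
  moreover have "grade A M \<le> enat 1" unfolding grade_def
    by (intro Sup_least) (use regular_seq_length_le[OF M] in auto)
  ultimately show "grade A M = 1" by (simp add: one_enat_def)
qed

theorem cohen_macaulay_iff:
  "cohen_macaulay A \<longleftrightarrow> noetherian_ring A \<and>
     (\<forall>M. maximalideal M A \<longrightarrow> (\<exists>z \<in> M. \<forall>y \<in> carrier A. z \<otimes> y = \<zero> \<longrightarrow> y = \<zero>))"
  unfolding cohen_macaulay_def
  using height_maximalideal grade_maximalideal_eq_1_iff cring_axioms by auto

end

text \<open>A leading-term argument: let n be a level of z if z lies in \<open>F (Suc n)\<close> but
  not in \<open>F n\<close>. By \<open>step\<close>, an element can be lowered by a multiple of any
  other element of the same level, so an ideal is generated by elements reaching all its levels.
  Multiplication by \<open>X\<close> raises levels from \<open>B\<close> on by \<open>K\<close>,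
  hence finitely many generators suffice: one for each level below \<open>B\<close>, and one for the
  least level from \<open>B\<close> on in each residue class modulo \<open>K\<close>.\<close>

lemma (in cring) noetherian_ring_filtration:
  fixes F :: "nat \<Rightarrow> 'a set" and K B :: nat
  assumes F0: "F 0 = {\<zero>}" and FU: "carrier R = (\<Union>n. F n)" and K: "K > 0"
    and step: "\<And>n y z. \<lbrakk>y \<in> F (Suc n); z \<in> F (Suc n); z \<notin> F n\<rbrakk> \<Longrightarrow> \<exists>c \<in> carrier R. y \<ominus> c \<otimes> z \<in> F n"
    and X: "X \<in> carrier R"
    and shift: "\<And>n z. \<lbrakk>B \<le> n; z \<in> carrier R\<rbrakk> \<Longrightarrow> X \<otimes> z \<in> F (n + K) \<longleftrightarrow> z \<in> F n"
  shows "noetherian_ring R"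
proof (rule noetherian_ringI)
  fix I assume "ideal I R"
  then interpret I: ideal I R .
  define L where "L n = F (Suc n) - F n" for n
  have shiftL: "X [^] s \<otimes> z \<in> L (n + s * K)" if "B \<le> n" "z \<in> L n" for s n z
  proof (induction s)
    case 0
    have "z \<in> carrier R" using that FU by (auto simp: L_def)
    then show ?case using that by simp
  next
    case (Suc s)
    have zc: "z \<in> carrier R" using that FU by (auto simp: L_def)
    have eq: "X [^] Suc s \<otimes> z = X \<otimes> (X [^] s \<otimes> z)"
      using X zc by (simp add: m_assoc m_comm m_lcomm)
    show ?case
      using Suc shift[of "n + s * K" "X [^] s \<otimes> z"] shift[of "Suc (n + s * K)" "X [^] s \<otimes> z"] that X zc
      unfolding eq by (auto simp: L_def algebra_simps)
  qed
  define V where "V = {n. I \<inter> L n \<noteq> {}}"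
  define E where "E = {v \<in> V. v < B} \<union> (\<lambda>r. LEAST u. u \<in> V \<and> B \<le> u \<and> u mod K = r) ` {..<K}"
  \<comment> \<open>In a residue class without levels of \<open>I\<close> the \<open>LEAST\<close>
    is meaningless; intersecting with \<open>V\<close> keeps only attained levels.\<close>
  define E' where "E' = E \<inter> V"
  have finE: "finite E'" by (simp add: E'_def E_def)
  have cover: "\<exists>f \<in> E'. \<exists>s. v = f + s * K \<and> (s = 0 \<or> B \<le> f)" if v: "v \<in> V" for v
  proof (cases "v < B")
    case True
    then show ?thesis using v by (intro bexI[of _ v] exI[of _ 0]) (auto simp: E'_def E_def)
  next
    case False
    let ?P = "\<lambda>u. u \<in> V \<and> B \<le> u \<and> u mod K = v mod K"
    define f where "f = (LEAST u. ?P u)"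
    have Pv: "?P v" using v False by simp
    have f: "?P f" unfolding f_def using Pv by (rule LeastI)
    then have f': "v mod K = f mod K" by (elim conjE) (rule sym)
    have le: "f \<le> v" unfolding f_def using Pv by (rule Least_le)
    have "f \<in> E" unfolding E_def f_def using K by (intro UnI2 image_eqI[of _ _ "v mod K"]) auto
    then have fE: "f \<in> E'" using f by (simp add: E'_def)
    have "K dvd v - f" using mod_eq_dvd_iff_nat[OF le, of K] f' by (rule iffD1)
    then obtain s where "v - f = K * s" by (elim dvdE)
    then have v_eq: "v = f + s * K" using le by (simp add: mult.commute)
    show ?thesis using f by (intro bexI[OF _ fE] exI[of _ s] conjI v_eq) simp
  qed
  define \<gamma> where "\<gamma> f = (SOME z. z \<in> I \<inter> L f)" for f
  have \<gamma>: "\<gamma> f \<in> I \<inter> L f" if "f \<in> E'" for f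
  proof -
    have "\<exists>z. z \<in> I \<inter> L f" using that by (auto simp: E'_def V_def)
    then show ?thesis unfolding \<gamma>_def by (rule someI_ex)
  qed
  let ?G = "\<gamma> ` E'"
  have GI: "?G \<subseteq> I" using \<gamma> by blast
  then have Gc: "?G \<subseteq> carrier R" using I.a_subset by blast
  interpret G: ideal "Idl ?G" R by (rule genideal_ideal[OF Gc])
  have "y \<in> Idl ?G" if "y \<in> I" "y \<in> F n" for y n using that
  proof (induction n arbitrary: y)
    case 0
    then show ?case using F0 by simp
  next
    case (Suc n)
    show ?case
    proof (cases "y \<in> F n")
      case True
      then show ?thesis using Suc by blast
    next
      case False
      then have "n \<in> V" using Suc by (auto simp: V_def L_def)
      then obtain f s where f: "f \<in> E'" "n = f + s * K" "s = 0 \<or> B \<le> f" using cover by blast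
      define z where "z = X [^] s \<otimes> \<gamma> f"
      have \<gamma>G: "\<gamma> f \<in> Idl ?G" using genideal_self[OF Gc] f(1) by blast
      have zG: "z \<in> Idl ?G" unfolding z_def using G.I_l_closed[OF \<gamma>G] X by simp
      have zI: "z \<in> I" unfolding z_def using I.I_l_closed \<gamma>[OF f(1)] X by simp
      have zL: "z \<in> L n"
      proof (cases "s = 0")
        case True
        then show ?thesis using \<gamma>[OF f(1)] f(2) I.Icarr by (auto simp: z_def)
      next
        case False
        then show ?thesis using shiftL[of f "\<gamma> f" s] \<gamma>[OF f(1)] f by (auto simp: z_def)
      qed
      then obtain c where c: "c \<in> carrier R" "y \<ominus> c \<otimes> z \<in> F n"
        using step[of y n z] Suc.prems(2) by (auto simp: L_def)
      have yc: "y \<in> carrier R" and zc: "z \<in> carrier R" using Suc.prems zI I.Icarr by auto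
      have "y \<ominus> c \<otimes> z \<in> I" unfolding a_minus_def
        using Suc.prems(1) I.I_l_closed[OF zI c(1)] by simp
      then have "y \<ominus> c \<otimes> z \<in> Idl ?G" using Suc.IH c(2) by blast
      then have "(y \<ominus> c \<otimes> z) \<oplus> c \<otimes> z \<in> Idl ?G" using G.I_l_closed[OF zG c(1)] by simp
      then show ?thesis using yc zc c(1) by (simp add: a_minus_def a_assoc l_neg)
    qed
  qed
  then have "I \<subseteq> Idl ?G" using I.a_subset FU by blast
  moreover have "Idl ?G \<subseteq> I" by (rule genideal_minimal[OF I.is_ideal GI])
  ultimately show "\<exists>A \<subseteq> carrier R. finite A \<and> I = Idl A"
    using finE Gc by (intro exI[of _ ?G]) auto
qed

section \<open>Powers of the maximal ideal and the associated graded ring\<close>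

lemma fps_nth_mult_lowest:
  fixes a b :: "'a::comm_ring_1 fps"
  assumes "fps_X ^ m dvd a" "fps_X ^ n dvd b"
  shows "fps_nth (a * b) (m + n) = fps_nth a m * fps_nth b n"
proof -
  obtain a' b' where ab: "a = fps_X ^ m * a'" "b = fps_X ^ n * b'" using assms by (elim dvdE)
  have "a * b = fps_X ^ (m + n) * (a' * b')" by (simp add: ab power_add algebra_simps)
  then show ?thesis by (simp add: ab fps_X_power_mult_nth)
qed

lemma fps_X_power_dvd_iff:
  fixes a :: "'a::field fps"
  shows "fps_X ^ m dvd a \<longleftrightarrow> (\<forall>k<m. fps_nth a k = 0)"
proof (cases "a = 0")
  case False
  then have "fps_X ^ m dvd a \<longleftrightarrow> m \<le> subdegree a" by (simp add: fps_dvd_iff)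
  also have "\<dots> \<longleftrightarrow> (\<forall>k<m. fps_nth a k = 0)"
    using False by (metis nth_less_subdegree_zero order_less_le_trans subdegree_geI nth_subdegree_nonzero not_le)
  finally show ?thesis .
qed simp

lemma ideal_prod_add:
  "\<lbrakk>u \<in> ideal_prod A B; v \<in> ideal_prod A B\<rbrakk> \<Longrightarrow> u + v \<in> ideal_prod A B"
  by (induction rule: ideal_prod.induct) (auto simp: add.assoc intro: ideal_prod.intros)

locale fps_subalgebra =
  fixes R :: "'a::field fps set"
  assumes constants: "fps_const c \<in> R"
    and add_closed: "\<lbrakk>a \<in> R; b \<in> R\<rbrakk> \<Longrightarrow> a + b \<in> R"
    and mult_closed: "\<lbrakk>a \<in> R; b \<in> R\<rbrakk> \<Longrightarrow> a * b \<in> R"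
    and uminus_closed: "a \<in> R \<Longrightarrow> - a \<in> R"
    and conductor: "\<exists>y. y \<noteq> 0 \<and> (\<forall>f :: 'a fps. y * f \<in> R)"
begin

lemma zero_closed: "0 \<in> R" and one_closed: "1 \<in> R"
  using constants[of 0] constants[of 1] by simp_all

lemma ex_value: "\<exists>c. \<forall>n\<ge>c. n \<in> valset R"
proof -
  obtain y where y: "y \<noteq> 0" "\<And>f. y * f \<in> R" using conductor by blast
  have "n \<in> valset R" if "subdegree y \<le> n" for n
  proof -
    have "n = subdegree (y * fps_X ^ (n - subdegree y))" using y(1) that by simp
    moreover have "y * fps_X ^ (n - subdegree y) \<in> R - {0}" using y by simp
    ultimately show ?thesis unfolding valset_def by (rule image_eqI)
  qed
  then show ?thesis by blast
qed

lemma mult_e_pos: "0 < mult_e R" and mult_e_value: "mult_e R \<in> valset R"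
proof -
  obtain c where "\<forall>n\<ge>c. n \<in> valset R" using ex_value by blast
  then have "0 < Suc c \<and> Suc c \<in> valset R" by simp
  then have "0 < mult_e R \<and> mult_e R \<in> valset R" unfolding mult_e_def by (rule LeastI)
  then show "0 < mult_e R" "mult_e R \<in> valset R" by simp_all
qed

lemma ex_mult_e_element: "\<exists>x \<in> mideal R. x \<noteq> 0 \<and> subdegree x = mult_e R"
proof -
  obtain x where x: "x \<in> R - {0}" "mult_e R = subdegree x"
    using mult_e_value unfolding valset_def by (rule imageE)
  have "0 < subdegree x" using mult_e_pos unfolding x(2) .
  then have "fps_nth x 0 = 0" by (rule nth_less_subdegree_zero)
  then have "x \<in> mideal R" using x(1) by (simp add: mideal_def)
  moreover have "x \<noteq> 0" using x(1) by simp
  ultimately show ?thesis using x(2)[symmetric] by blast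
qed

lemma mideal_subset: "mideal R \<subseteq> R"
  by (auto simp: mideal_def)

lemma mideal_dvd: "a \<in> mideal R \<Longrightarrow> fps_X ^ mult_e R dvd a"
proof (cases "a = 0")
  case False
  assume a: "a \<in> mideal R"
  then have "0 < subdegree a" using False subdegree_eq_0_iff[of a] by (auto simp: mideal_def)
  moreover have "subdegree a \<in> valset R" using a False by (auto simp: mideal_def valset_def)
  ultimately have "mult_e R \<le> subdegree a" unfolding mult_e_def by (intro Least_le) simp
  then show ?thesis using False by (simp add: fps_dvd_iff)
qed simp

lemma mpow_zero: "0 \<in> mpow R i"
  by (cases i) (auto simp: zero_closed intro: ideal_prod.zero)

lemma mpow_add: "\<lbrakk>a \<in> mpow R i; b \<in> mpow R i\<rbrakk> \<Longrightarrow> a + b \<in> mpow R i"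
  by (cases i) (auto simp: add_closed intro: ideal_prod_add)

lemma mpow_smult: "\<lbrakk>a \<in> mpow R i; r \<in> R\<rbrakk> \<Longrightarrow> r * a \<in> mpow R i"
proof (induction i arbitrary: a)
  case (Suc i)
  from Suc.prems(1) have "a \<in> ideal_prod (mpow R i) (mideal R)" by simp
  then have "r * a \<in> ideal_prod (mpow R i) (mideal R)"
  proof induction
    case (step b c u)
    have "(r * b) * c + r * u \<in> ideal_prod (mpow R i) (mideal R)"
      using step Suc.IH Suc.prems(2) by (intro ideal_prod.step) auto
    then show ?case by (simp add: algebra_simps)
  qed (simp add: ideal_prod.zero)
  then show ?case by simp
qed (simp add: mult_closed)

lemma mpow_uminus: "a \<in> mpow R i \<Longrightarrow> - a \<in> mpow R i"
  using mpow_smult[of a i "-1"] uminus_closed[OF one_closed] by simp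

lemma mpow_diff: "\<lbrakk>a \<in> mpow R i; b \<in> mpow R i\<rbrakk> \<Longrightarrow> a - b \<in> mpow R i"
  using mpow_add[OF _ mpow_uminus] by force

lemma mpow_sum: "(\<And>l. l \<in> L \<Longrightarrow> f l \<in> mpow R i) \<Longrightarrow> sum f L \<in> mpow R i"
  by (induction L rule: infinite_finite_induct) (auto simp: mpow_zero mpow_add)

lemma mpow_mult_mideal: "\<lbrakk>a \<in> mpow R i; b \<in> mideal R\<rbrakk> \<Longrightarrow> a * b \<in> mpow R (Suc i)"
  using ideal_prod.step[OF _ _ ideal_prod.zero] by force

lemma mpow_mult: "\<lbrakk>a \<in> mpow R i; b \<in> mpow R j\<rbrakk> \<Longrightarrow> a * b \<in> mpow R (i + j)"
proof (induction j arbitrary: b)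
  case 0
  then show ?case using mpow_smult[of a i b] by (simp add: mult.commute)
next
  case (Suc j)
  from Suc.prems(2) have "b \<in> ideal_prod (mpow R j) (mideal R)" by simp
  then show ?case
  proof induction
    case (step c d u)
    have "a * c * d + a * u \<in> mpow R (i + Suc j)"
      using mpow_mult_mideal[OF Suc.IH[OF Suc.prems(1) step(1)] step(2)] step
      by (intro mpow_add) simp_all
    then show ?case by (simp add: algebra_simps)
  qed (simp add: mpow_zero del: mpow.simps)
qed

lemma mpow_Suc_subset: "mpow R (Suc i) \<subseteq> mpow R i"
proof
  fix a assume "a \<in> mpow R (Suc i)"
  then have "a \<in> ideal_prod (mpow R i) (mideal R)" by simp
  then show "a \<in> mpow R i"
  proof induction
    case (step b c u)
    then show ?case using mpow_smult[of b i c] mideal_subset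
      by (auto simp: mult.commute intro: mpow_add)
  qed (simp add: mpow_zero)
qed

lemma mpow_antimono: "i \<le> j \<Longrightarrow> mpow R j \<subseteq> mpow R i"
  by (rule lift_Suc_antimono_le[of "mpow R"]) (rule mpow_Suc_subset)

lemma mpow_subset: "mpow R i \<subseteq> R"
  using mpow_antimono[of 0 i] by simp

lemma mpow_1: "mpow R (Suc 0) = mideal R"
proof
  show "mideal R \<subseteq> mpow R (Suc 0)" using mpow_mult_mideal[of 1 0] one_closed by auto
  show "mpow R (Suc 0) \<subseteq> mideal R"
  proof
    fix a assume "a \<in> mpow R (Suc 0)"
    then have "a \<in> ideal_prod R (mideal R)" by simp
    then show "a \<in> mideal R"
      by induction (auto simp: mideal_def zero_closed intro: add_closed mult_closed)
  qed
qed

lemma mpow_dvd: "a \<in> mpow R i \<Longrightarrow> fps_X ^ (i * mult_e R) dvd a"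
proof (induction i arbitrary: a)
  case (Suc i)
  from Suc.prems have "a \<in> ideal_prod (mpow R i) (mideal R)" by simp
  then show ?case
  proof induction
    case (step b c u)
    have "fps_X ^ (i * mult_e R) * fps_X ^ mult_e R dvd b * c"
      using Suc.IH[OF step(1)] mideal_dvd[OF step(2)] by (rule mult_dvd_mono)
    then show ?case using step by (simp add: power_add[symmetric] add.commute)
  qed simp
qed simp

lemma mpow_power: "a \<in> mideal R \<Longrightarrow> a ^ i \<in> mpow R i"
proof (induction i)
  case (Suc i)
  then show ?case using mpow_mult_mideal[of "a ^ i" i a] by (simp add: mult.commute del: mpow.simps)
qed (simp add: one_closed)

text \<open>The constant is the order of a conductor element \<open>y\<close>: a series of order at
  least i e + ord y is \<open>x ^ i * y\<close> times a series, and \<open>y\<close> carries that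
  series into \<open>R\<close>. It is the same for all i.\<close>

lemma mpow_conductor: "\<exists>c. \<forall>i a. fps_X ^ (i * mult_e R + c) dvd a \<longrightarrow> a \<in> mpow R i"
proof -
  obtain y where y: "y \<noteq> 0" "\<And>f. y * f \<in> R" using conductor by blast
  obtain x where xm: "x \<in> mideal R" and x: "x \<noteq> 0" "subdegree x = mult_e R"
    using ex_mult_e_element by blast
  have "a \<in> mpow R i" if a: "fps_X ^ (i * mult_e R + subdegree y) dvd a" for i a
  proof (cases "a = 0")
    case False
    then have "x ^ i * y dvd a" using a x y by (simp add: fps_dvd_iff)
    then obtain g where "a = x ^ i * y * g" by (elim dvdE)
    then have "a = y * g * x ^ i" by (simp add: algebra_simps)
    then show ?thesis using mpow_smult[OF mpow_power[OF xm] y(2)] by simp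
  qed (simp add: mpow_zero)
  then show ?thesis by blast
qed

text \<open>The Rees ring of the filtration, inside the polynomial ring over the power series;
  \<open>gr(R)\<close> is its quotient by \<open>rees_ker\<close>.\<close>
definition rees :: "'a fps poly set" where
  "rees = {p. \<forall>i. coeff p i \<in> mpow R i}"

definition rees_ker :: "'a fps poly set" where
  "rees_ker = {p. \<forall>i. coeff p i \<in> mpow R (Suc i)}"

definition gr_proj :: "'a fps poly \<Rightarrow> nat \<Rightarrow> 'a fps set" where
  "gr_proj p = (\<lambda>i. grcoset R i (coeff p i))"

section \<open>The Rees ring and its quotient gr(R)\<close>

lemma rees_add: "\<lbrakk>p \<in> rees; q \<in> rees\<rbrakk> \<Longrightarrow> p + q \<in> rees"
  and rees_diff: "\<lbrakk>p \<in> rees; q \<in> rees\<rbrakk> \<Longrightarrow> p - q \<in> rees"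
  and rees_uminus: "p \<in> rees \<Longrightarrow> - p \<in> rees"
  by (simp_all add: rees_def mpow_add mpow_diff mpow_uminus)

lemma rees_0: "0 \<in> rees"
  by (simp add: rees_def mpow_zero)

lemma rees_1: "1 \<in> rees"
  by (simp add: rees_def coeff_1 one_closed mpow_zero)

lemma rees_mult: "\<lbrakk>p \<in> rees; q \<in> rees\<rbrakk> \<Longrightarrow> p * q \<in> rees"
  unfolding rees_def mem_Collect_eq coeff_mult
  by (intro allI mpow_sum) (metis mpow_mult le_add_diff_inverse atMost_iff)

lemma rees_power: "p \<in> rees \<Longrightarrow> p ^ n \<in> rees"
  by (induction n) (simp_all add: rees_1 rees_mult)

lemma rees_monom: "a \<in> mpow R i \<Longrightarrow> monom a i \<in> rees"
  by (simp add: rees_def mpow_zero)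

lemma rees_ker_mult: "\<lbrakk>p \<in> rees; q \<in> rees_ker\<rbrakk> \<Longrightarrow> p * q \<in> rees_ker"
  unfolding rees_def rees_ker_def mem_Collect_eq coeff_mult
  by (intro allI mpow_sum) (metis mpow_mult le_add_diff_inverse atMost_iff add_Suc_right)

lemma rees_ker_add: "\<lbrakk>p \<in> rees_ker; q \<in> rees_ker\<rbrakk> \<Longrightarrow> p + q \<in> rees_ker"
  by (simp add: rees_ker_def mpow_add del: mpow.simps)

lemma grcoset_eq_iff: "grcoset R i a = grcoset R i b \<longleftrightarrow> a - b \<in> mpow R (Suc i)"
proof
  assume "grcoset R i a = grcoset R i b"
  moreover have "a \<in> grcoset R i a"
    using mpow_zero[of "Suc i"] by (force simp: grcoset_def simp del: mpow.simps)
  ultimately show "a - b \<in> mpow R (Suc i)" by (auto simp: grcoset_def simp del: mpow.simps)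
next
  assume ab: "a - b \<in> mpow R (Suc i)"
  have sub: "grcoset R i u \<subseteq> grcoset R i v" if "u - v \<in> mpow R (Suc i)" for u v
  proof
    fix w assume "w \<in> grcoset R i u"
    then obtain y where "y \<in> mpow R (Suc i)" "w = u + y" unfolding grcoset_def by blast
    then have "w = v + ((u - v) + y)" "(u - v) + y \<in> mpow R (Suc i)"
      using mpow_add[OF that] by auto
    then show "w \<in> grcoset R i v" unfolding grcoset_def by blast
  qed
  show "grcoset R i a = grcoset R i b"
    using sub[OF ab] sub[of b a] mpow_uminus[OF ab] by auto
qed

lemma grcoset_zero: "grcoset R i 0 = mpow R (Suc i)"
  by (auto simp: grcoset_def)

lemma gr_proj_eq_iff: "gr_proj p = gr_proj q \<longleftrightarrow> p - q \<in> rees_ker"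
  by (simp add: gr_proj_def fun_eq_iff grcoset_eq_iff rees_ker_def del: mpow.simps)

lemma gr_carrier_eq: "gr_carrier R = gr_proj ` rees"
proof
  show "gr_proj ` rees \<subseteq> gr_carrier R"
  proof
    fix c assume "c \<in> gr_proj ` rees"
    then obtain p where p: "c = gr_proj p" "p \<in> rees" by blast
    have "{i. c i \<noteq> mpow R (Suc i)} \<subseteq> {..degree p}"
      using coeff_eq_0[of p] by (force simp: p gr_proj_def grcoset_zero simp del: mpow.simps)
    then have "finite {i. c i \<noteq> mpow R (Suc i)}" by (rule finite_subset) simp
    then show "c \<in> gr_carrier R" using p
      by (auto simp: gr_carrier_def gr_proj_def rees_def)
  qed
  show "gr_carrier R \<subseteq> gr_proj ` rees"
  proof
    fix c assume "c \<in> gr_carrier R"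
    then have c: "\<forall>i. \<exists>a. a \<in> mpow R i \<and> c i = grcoset R i a" "finite {i. c i \<noteq> mpow R (Suc i)}"
      unfolding gr_carrier_def by blast+
    from c(1) obtain f where f: "\<And>i. f i \<in> mpow R i" "\<And>i. c i = grcoset R i (f i)" by metis
    from c(2) obtain d where d: "\<And>i. c i \<noteq> mpow R (Suc i) \<Longrightarrow> i \<le> d"
      using finite_nat_set_iff_bounded_le by auto
    \<comment> \<open>Above \<open>d\<close> the coset is m^(i+1) itself, which 0 represents;
      truncating there gives a polynomial.\<close>
    let ?p = "Abs_poly (\<lambda>i. if i \<le> d then f i else 0)"
    have "?p \<in> rees" by (simp add: rees_def coeff_Abs_poly_If_le f mpow_zero)
    moreover have "c = gr_proj ?p"
      using f(2) d by (auto simp: gr_proj_def coeff_Abs_poly_If_le grcoset_zero fun_eq_iff simp del: mpow.simps)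
    ultimately show "c \<in> gr_proj ` rees" by blast
  qed
qed

text \<open>The representative picked by choice differs from the coefficient only by an element of
  the next power, an error to which sums and products in gr(R) are insensitive.\<close>

lemma grrep_gr_proj:
  assumes "p \<in> rees"
  shows "grrep R (gr_proj p) i \<in> mpow R i" "grrep R (gr_proj p) i - coeff p i \<in> mpow R (Suc i)"
proof -
  have "\<exists>a. a \<in> mpow R i \<and> gr_proj p i = grcoset R i a"
    using assms by (auto simp: rees_def gr_proj_def)
  then have *: "grrep R (gr_proj p) i \<in> mpow R i \<and> gr_proj p i = grcoset R i (grrep R (gr_proj p) i)"
    unfolding grrep_def by (rule someI_ex)
  then show "grrep R (gr_proj p) i \<in> mpow R i" by blast
  from * have "grcoset R i (grrep R (gr_proj p) i) = grcoset R i (coeff p i)" by (simp add: gr_proj_def)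
  then show "grrep R (gr_proj p) i - coeff p i \<in> mpow R (Suc i)" by (simp only: grcoset_eq_iff)
qed

lemma gr_carrier_simp: "carrier (gr_ring R) = gr_proj ` rees"
  by (simp add: gr_ring_def gr_carrier_eq)

lemma gr_zero: "\<zero>\<^bsub>gr_ring R\<^esub> = gr_proj 0"
  by (simp add: gr_ring_def gr_proj_def)

lemma gr_one: "\<one>\<^bsub>gr_ring R\<^esub> = gr_proj 1"
  by (auto simp: gr_ring_def gr_proj_def coeff_1 fun_eq_iff)

lemma gr_add:
  assumes "p \<in> rees" "q \<in> rees"
  shows "gr_proj p \<oplus>\<^bsub>gr_ring R\<^esub> gr_proj q = gr_proj (p + q)"
proof -
  have "grrep R (gr_proj p) n + grrep R (gr_proj q) n - (coeff p n + coeff q n) \<in> mpow R (Suc n)" for n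
    using mpow_add[OF grrep_gr_proj(2)[OF assms(1), of n] grrep_gr_proj(2)[OF assms(2), of n]]
    by (simp add: algebra_simps)
  then show ?thesis by (simp add: gr_ring_def gr_proj_def fun_eq_iff grcoset_eq_iff del: mpow.simps)
qed

lemma gr_mult:
  assumes "p \<in> rees" "q \<in> rees"
  shows "gr_proj p \<otimes>\<^bsub>gr_ring R\<^esub> gr_proj q = gr_proj (p * q)"
proof -
  let ?f = "grrep R (gr_proj p)" and ?g = "grrep R (gr_proj q)"
  \<comment> \<open>Changing one factor at a time, f g - p q = f (g - q) + (f - p) q; each summand
    has one factor in the next power.\<close>
  have mult_term: "?f i * ?g j - coeff p i * coeff q j \<in> mpow R (Suc (i + j))" for i j
  proof -
    have "?f i * (?g j - coeff q j) \<in> mpow R (i + Suc j)"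
      by (intro mpow_mult grrep_gr_proj assms)
    moreover have "(?f i - coeff p i) * coeff q j \<in> mpow R (Suc i + j)"
      using assms by (intro mpow_mult grrep_gr_proj assms) (simp add: rees_def)
    ultimately have "?f i * (?g j - coeff q j) + (?f i - coeff p i) * coeff q j \<in> mpow R (Suc (i + j))"
      by (intro mpow_add) simp_all
    then show ?thesis by (simp add: algebra_simps)
  qed
  have "(\<Sum>i\<le>n. ?f i * ?g (n - i)) - coeff (p * q) n \<in> mpow R (Suc n)" for n
    unfolding coeff_mult sum_subtractf[symmetric]
    by (rule mpow_sum) (metis mult_term atMost_iff le_add_diff_inverse)
  then show ?thesis by (simp add: gr_ring_def gr_proj_def fun_eq_iff grcoset_eq_iff del: mpow.simps)
qed

lemma cring_gr: "cring (gr_ring R)"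
proof (rule cringI)
  show "abelian_group (gr_ring R)"
  proof (rule abelian_groupI)
    fix u assume "u \<in> carrier (gr_ring R)"
    then obtain p where p: "u = gr_proj p" "p \<in> rees" by (auto simp: gr_carrier_simp)
    then show "\<exists>y\<in>carrier (gr_ring R). y \<oplus>\<^bsub>gr_ring R\<^esub> u = \<zero>\<^bsub>gr_ring R\<^esub>"
      by (intro bexI[of _ "gr_proj (- p)"]) (auto simp: gr_carrier_simp gr_add gr_zero rees_uminus)
  qed (auto simp: gr_carrier_simp gr_add gr_zero rees_add rees_0 algebra_simps)
  show "comm_monoid (gr_ring R)"
    by (rule comm_monoidI) (auto simp: gr_carrier_simp gr_mult gr_one rees_mult rees_1 algebra_simps)
qed (auto simp: gr_carrier_simp gr_add gr_mult rees_add rees_mult algebra_simps)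

lemma gr_minus:
  assumes "p \<in> rees" "q \<in> rees"
  shows "gr_proj p \<ominus>\<^bsub>gr_ring R\<^esub> gr_proj q = gr_proj (p - q)"
proof -
  interpret cring "gr_ring R" by (rule cring_gr)
  have "gr_proj (- q) = \<ominus>\<^bsub>gr_ring R\<^esub> gr_proj q"
    by (rule minus_equality[symmetric]) (use assms in \<open>auto simp: gr_carrier_simp gr_add gr_zero rees_uminus\<close>)
  then have "gr_proj p \<ominus>\<^bsub>gr_ring R\<^esub> gr_proj q = gr_proj p \<oplus>\<^bsub>gr_ring R\<^esub> gr_proj (- q)"
    by (simp add: a_minus_def)
  then show ?thesis using assms by (simp add: gr_add rees_uminus)
qed

lemma gr_power:
  assumes "p \<in> rees"
  shows "gr_proj p [^]\<^bsub>gr_ring R\<^esub> (n::nat) = gr_proj (p ^ n)"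
proof -
  interpret cring "gr_ring R" by (rule cring_gr)
  show ?thesis by (induction n) (use assms in \<open>simp_all add: gr_one gr_mult rees_power mult.commute\<close>)
qed

lemma gr_proj_eq_zero_iff: "gr_proj p = \<zero>\<^bsub>gr_ring R\<^esub> \<longleftrightarrow> p \<in> rees_ker"
  by (simp add: gr_zero gr_proj_eq_iff)

lemma gr_nonzerodivisor_iff:
  assumes "p \<in> rees"
  shows "(\<forall>y \<in> carrier (gr_ring R). gr_proj p \<otimes>\<^bsub>gr_ring R\<^esub> y = \<zero>\<^bsub>gr_ring R\<^esub> \<longrightarrow> y = \<zero>\<^bsub>gr_ring R\<^esub>)
    \<longleftrightarrow> (\<forall>q \<in> rees. p * q \<in> rees_ker \<longrightarrow> q \<in> rees_ker)"
  using assms by (auto simp: gr_carrier_simp gr_mult gr_proj_eq_zero_iff)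

text \<open>Since \<open>m\<^sup>i\<close> consists of series of order at least \<open>i e\<close>, the coefficient of \<open>t\<^sup>i\<^sup>e\<close> is multiplicative
  on homogeneous elements; this is the map onto the polynomial ring in one variable.\<close>
definition rees_lead :: "'a fps poly \<Rightarrow> 'a poly" where
  "rees_lead p = Abs_poly (\<lambda>i. fps_nth (coeff p i) (i * mult_e R))"

text \<open>The chosen preimage does not matter, by \<open>rees_lead_ker\<close>: in degree i the
  kernel has order at least (i+1) e, beyond the coefficient that is read off.\<close>

definition gr_lead :: "(nat \<Rightarrow> 'a fps set) \<Rightarrow> 'a poly" where
  "gr_lead c = rees_lead (SOME p. p \<in> rees \<and> gr_proj p = c)"

section \<open>The coefficient map onto k[X] is surjective with nil kernel\<close>

lemma coeff_rees_lead: "coeff (rees_lead p) i = fps_nth (coeff p i) (i * mult_e R)"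
  unfolding rees_lead_def by (subst coeff_Abs_poly[of "degree p"]) (auto simp: coeff_eq_0)

lemma rees_lead_add: "rees_lead (p + q) = rees_lead p + rees_lead q"
  and rees_lead_diff: "rees_lead (p - q) = rees_lead p - rees_lead q"
  by (simp_all add: poly_eq_iff coeff_rees_lead)

lemma rees_lead_1: "rees_lead 1 = 1"
  by (simp add: poly_eq_iff coeff_rees_lead coeff_1)

lemma rees_lead_mult:
  assumes "p \<in> rees" "q \<in> rees"
  shows "rees_lead (p * q) = rees_lead p * rees_lead q"
proof (rule poly_eqI)
  fix n
  have "fps_nth (coeff p i * coeff q (n - i)) (n * mult_e R)
      = fps_nth (coeff p i) (i * mult_e R) * fps_nth (coeff q (n - i)) ((n - i) * mult_e R)"
    if "i \<le> n" for i
  proof -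
    have "n * mult_e R = i * mult_e R + (n - i) * mult_e R"
      using that by (simp flip: add_mult_distrib)
    then show ?thesis using assms by (simp add: rees_def mpow_dvd fps_nth_mult_lowest)
  qed
  then show "coeff (rees_lead (p * q)) n = coeff (rees_lead p * rees_lead q) n"
    by (simp add: coeff_rees_lead coeff_mult fps_sum_nth)
qed

lemma rees_lead_ker: "p \<in> rees_ker \<Longrightarrow> rees_lead p = 0"
proof (rule poly_eqI)
  fix i assume "p \<in> rees_ker"
  then have "fps_X ^ (Suc i * mult_e R) dvd coeff p i" unfolding rees_ker_def using mpow_dvd by blast
  then show "coeff (rees_lead p) i = coeff 0 i"
    using mult_e_pos by (simp add: coeff_rees_lead fps_X_power_dvd_iff)
qed

lemma gr_lead_gr_proj:
  assumes "p \<in> rees"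
  shows "gr_lead (gr_proj p) = rees_lead p"
proof -
  let ?q = "SOME q. q \<in> rees \<and> gr_proj q = gr_proj p"
  have "?q \<in> rees \<and> gr_proj ?q = gr_proj p" by (rule someI[of _ p]) (use assms in simp)
  then have "?q - p \<in> rees_ker" by (simp add: gr_proj_eq_iff)
  then have "rees_lead (?q - p) = 0" by (rule rees_lead_ker)
  then show ?thesis by (simp add: gr_lead_def rees_lead_diff)
qed

text \<open>In degree i the coefficient of \<open>p\<close> has order at least i e + 1, that of
  \<open>p ^ n\<close> at least i e + n. For n = e + c, with c the conductor constant, this is (i+1)
  e + c, which forces membership in m^(i+1); one exponent serves all degrees.\<close>

lemma rees_lead_eq_0_nilpotent:
  assumes p: "p \<in> rees" and lead: "rees_lead p = 0"
  shows "\<exists>n. p ^ n \<in> rees_ker"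
proof -
  let ?e = "mult_e R"
  obtain c where c: "\<And>i a. fps_X ^ (i * ?e + c) dvd a \<Longrightarrow> a \<in> mpow R i" using mpow_conductor by blast
  have p1: "fps_X ^ (i * ?e + 1) dvd coeff p i" for i
  proof -
    have "fps_nth (coeff p i) (i * ?e) = 0" using lead by (simp flip: coeff_rees_lead)
    moreover have "fps_X ^ (i * ?e) dvd coeff p i" using p mpow_dvd by (simp add: rees_def)
    ultimately show ?thesis
      unfolding fps_X_power_dvd_iff by (auto simp: less_Suc_eq)
  qed
  have pn: "fps_X ^ (i * ?e + n) dvd coeff (p ^ n) i" for n i
  proof (induction n arbitrary: i)
    case 0
    then show ?case by (cases i) (simp_all add: coeff_1)
  next
    case (Suc n)
    have "fps_X ^ (i * ?e + Suc n) dvd coeff p j * coeff (p ^ n) (i - j)" if j: "j \<le> i" for j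
    proof -
      have "i * ?e + Suc n = (j * ?e + 1) + ((i - j) * ?e + n)"
        using j by (simp flip: add_mult_distrib)
      then show ?thesis using mult_dvd_mono[OF p1[of j] Suc.IH[of "i - j"]] by (simp only: power_add)
    qed
    then show ?case by (auto simp: coeff_mult intro: dvd_sum)
  qed
  have "coeff (p ^ (?e + c)) i \<in> mpow R (Suc i)" for i
    by (rule c) (use pn[of i "?e + c"] in \<open>simp add: algebra_simps\<close>)
  then show ?thesis unfolding rees_ker_def by blast
qed

text \<open>The lift is a polynomial in the initial form of \<open>x\<close> with coefficients in k,
  normalised by powers of the leading coefficient \<open>u\<close>. The last clause records this
  shape, on which the regularity of the lift is later tested.\<close>

lemma rees_lead_surj:
  assumes x: "x \<in> mideal R" "x \<noteq> 0" "subdegree x = mult_e R"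
  shows "\<exists>p \<in> rees. rees_lead p = g \<and> (\<forall>i. \<exists>c. coeff p i = fps_const c * x ^ i \<and> (c = 0 \<longleftrightarrow> coeff g i = 0))"
proof -
  define u where "u = fps_nth x (mult_e R)"
  have u: "u \<noteq> 0" using x by (simp add: u_def flip: x(3))
  define p where "p = Abs_poly (\<lambda>i. fps_const (coeff g i / u ^ i) * x ^ i)"
  have cp: "coeff p = (\<lambda>i. fps_const (coeff g i / u ^ i) * x ^ i)"
    unfolding p_def by (rule coeff_Abs_poly[of "degree g"]) (simp add: coeff_eq_0)
  have lead: "fps_nth (x ^ i) (i * mult_e R) = u ^ i" for i
  proof (induction i)
    case (Suc i)
    have "fps_nth (x * x ^ i) (mult_e R + i * mult_e R) = u * u ^ i"
      unfolding u_def using Suc x by (subst fps_nth_mult_lowest) (auto simp: mideal_dvd mpow_dvd mpow_power u_def)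
    then show ?case by simp
  qed simp
  have "p \<in> rees" by (simp add: rees_def cp mpow_smult[OF mpow_power[OF x(1)] constants])
  moreover have "rees_lead p = g" using u by (simp add: poly_eq_iff coeff_rees_lead cp lead)
  moreover have "\<exists>c. coeff p i = fps_const c * x ^ i \<and> (c = 0 \<longleftrightarrow> coeff g i = 0)" for i
    by (rule exI[of _ "coeff g i / u ^ i"]) (use u in \<open>simp add: cp\<close>)
  ultimately show ?thesis by blast
qed

lemma poly_quotient_gr: "poly_quotient (gr_ring R) gr_lead"
proof (rule poly_quotient.intro[OF cring_gr], unfold_locales)
  show "gr_lead \<one>\<^bsub>gr_ring R\<^esub> = 1" by (simp add: gr_one gr_lead_gr_proj rees_1 rees_lead_1)
  obtain x where x: "x \<in> mideal R" "x \<noteq> 0" "subdegree x = mult_e R"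
    using ex_mult_e_element by blast
  from rees_lead_surj[OF x] show "\<exists>a\<in>carrier (gr_ring R). gr_lead a = p" for p
    by (metis gr_carrier_simp gr_lead_gr_proj imageI)
  show "\<exists>n. a [^]\<^bsub>gr_ring R\<^esub> (n::nat) = \<zero>\<^bsub>gr_ring R\<^esub>" if "a \<in> carrier (gr_ring R)" "gr_lead a = 0" for a
    using that rees_lead_eq_0_nilpotent
    by (auto simp: gr_carrier_simp gr_lead_gr_proj gr_power gr_proj_eq_zero_iff)
qed (auto simp: gr_carrier_simp gr_add gr_mult gr_lead_gr_proj rees_add rees_mult rees_lead_add rees_lead_mult)

end


section \<open>Regularity of the initial form of a minimal reduction\<close>

text \<open>Since \<open>x\<close> lies in m, the opposite inclusion is automatic and m^(i+1) = x
  m^i from \<open>N\<close> on: \<open>x\<close> generates a reduction of m, with reduction number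
  at most \<open>N\<close>.\<close>

locale fps_subalgebra_reduction = fps_subalgebra +
  fixes x :: "'a fps" and N :: nat
  assumes x_mideal: "x \<in> mideal R" and x_nonzero: "x \<noteq> 0" and subdegree_x: "subdegree x = mult_e R"
    and reduction: "N \<le> i \<Longrightarrow> mpow R (Suc i) \<subseteq> (*) x ` mpow R i"
begin

lemma x_mult: "a \<in> mpow R i \<Longrightarrow> x * a \<in> mpow R (Suc i)"
  using mpow_mult_mideal[OF _ x_mideal] by (simp add: mult.commute del: mpow.simps)

lemma x_mult_iff: "N \<le> i \<Longrightarrow> x * a \<in> mpow R (Suc i) \<longleftrightarrow> a \<in> mpow R i"
  using reduction[of i] x_nonzero x_mult by (auto simp del: mpow.simps)

lemma x_rees: "monom x (Suc 0) \<in> rees"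
  by (rule rees_monom) (use x_mideal mpow_1 in simp)

lemma coeff_x_mult: "coeff (monom x (Suc 0) * p) i = (if i = 0 then 0 else x * coeff p (i - 1))"
  by (simp add: coeff_monom_mult)

text \<open>A condition on the class in gr(R): degree at most \<open>i\<close>, with
  degree-\<open>i\<close> component represented by a series \<open>a\<close> of order at least
  \<open>d\<close>. The representative is quantified because the order varies within a coset of
  m^(i+1).\<close>

definition filt :: "nat \<Rightarrow> nat \<Rightarrow> 'a fps poly \<Rightarrow> bool" where
  "filt i d p \<longleftrightarrow> (\<forall>l>i. coeff p l \<in> mpow R (Suc l)) \<and>
     (\<exists>a. fps_X ^ d dvd a \<and> coeff p i - a \<in> mpow R (Suc i))"

lemma filt_ker_add:
  assumes "filt i d p" "q - p \<in> rees_ker"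
  shows "filt i d q"
proof -
  have qp: "coeff q l - coeff p l \<in> mpow R (Suc l)" for l using assms(2) by (simp add: rees_ker_def)
  obtain a where a: "fps_X ^ d dvd a" "coeff p i - a \<in> mpow R (Suc i)"
    using assms(1) by (auto simp: filt_def)
  have "coeff q l \<in> mpow R (Suc l)" if "l > i" for l
  proof -
    have "coeff p l \<in> mpow R (Suc l)" using assms(1) that by (simp only: filt_def)
    from mpow_add[OF qp this] show ?thesis by (simp del: mpow.simps)
  qed
  moreover have "coeff q i - a \<in> mpow R (Suc i)"
    using mpow_add[OF qp a(2)] by (simp del: mpow.simps)
  ultimately show ?thesis using a(1) unfolding filt_def by blast
qed

text \<open>For the descent, the element of m^(i+2) that corrects the representative is
  \<open>x\<close> times an element of m^(i+1), since \<open>i\<close> has reached the reduction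
  bound; cancelling \<open>x\<close> lowers orders by e.\<close>

lemma filt_x_mult_iff:
  assumes "p \<in> rees" "N \<le> i"
  shows "filt (Suc i) (mult_e R + d) (monom x (Suc 0) * p) \<longleftrightarrow> filt i d p"
proof -
  have tail: "(\<forall>l>Suc i. coeff (monom x (Suc 0) * p) l \<in> mpow R (Suc l)) \<longleftrightarrow>
    (\<forall>l>i. coeff p l \<in> mpow R (Suc l))" (is "?L \<longleftrightarrow> ?R")
  proof
    assume L: ?L
    show ?R
    proof safe
      fix l assume l: "l > i"
      have "x * coeff p l \<in> mpow R (Suc (Suc l))"
        using L[rule_format, of "Suc l"] l by (simp add: coeff_x_mult del: mpow.simps)
      then show "coeff p l \<in> mpow R (Suc l)" using x_mult_iff[of "Suc l"] l assms(2) by simp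
    qed
  next
    assume R: ?R
    show ?L
    proof safe
      fix l assume l: "l > Suc i"
      then obtain l' where l': "l = Suc l'" "l' > i" by (cases l) auto
      have "x * coeff p l' \<in> mpow R (Suc (Suc l'))" using R l'(2) by (intro x_mult) blast
      then show "coeff (monom x (Suc 0) * p) l \<in> mpow R (Suc l)"
        using l' by (simp add: coeff_x_mult del: mpow.simps)
    qed
  qed
  have X: "fps_X ^ (mult_e R + d) dvd x * a \<longleftrightarrow> fps_X ^ d dvd a" for a
    by (cases "a = 0") (use x_nonzero subdegree_x in \<open>simp_all add: fps_dvd_iff del: power_add\<close>)
  have "(\<exists>a. fps_X ^ (mult_e R + d) dvd a \<and> x * coeff p i - a \<in> mpow R (Suc (Suc i))) \<longleftrightarrow>
    (\<exists>a. fps_X ^ d dvd a \<and> coeff p i - a \<in> mpow R (Suc i))" (is "?L \<longleftrightarrow> ?R")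
  proof
    assume ?L
    then obtain a where a: "fps_X ^ (mult_e R + d) dvd a" "x * coeff p i - a \<in> mpow R (Suc (Suc i))"
      by blast
    then obtain b where b: "b \<in> mpow R (Suc i)" "x * coeff p i - a = x * b"
      using reduction[of "Suc i"] assms(2) by (metis imageE le_SucI subsetD)
    have "a = x * (coeff p i - b)" using b(2) by (simp add: algebra_simps)
    then have "fps_X ^ d dvd coeff p i - b" using a(1) X by metis
    moreover have "coeff p i - (coeff p i - b) \<in> mpow R (Suc i)" using b(1) by simp
    ultimately show ?R by blast
  next
    assume ?R
    then obtain a where a: "fps_X ^ d dvd a" "coeff p i - a \<in> mpow R (Suc i)" by blast
    have "x * coeff p i - x * a \<in> mpow R (Suc (Suc i))"
      using x_mult[OF a(2)] by (simp add: algebra_simps del: mpow.simps)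
    then show ?L using a(1) X by blast
  qed
  then show ?thesis unfolding filt_def tail by (simp add: coeff_x_mult del: mpow.simps)
qed

text \<open>Every homogeneous component has finite length, bounded by \<open>K\<close> independently of the degree: an element of
  \<open>m\<^sup>i\<close> of order at least \<open>i e + K\<close> lies in \<open>m\<^sup>i\<^sup>+\<^sup>1\<close>. Filtering by degree and, within one degree, by
  order therefore gives a filtration indexed by \<open>\<nat>\<close> with steps of dimension at most one, and
  multiplication by the initial form of \<open>x\<close> eventually shifts it by \<open>K\<close>.\<close>
lemma noetherian_ring_gr: "noetherian_ring (gr_ring R)"
proof -
  interpret G: cring "gr_ring R" by (rule cring_gr)
  let ?e = "mult_e R"
  obtain c where c: "\<And>i a. fps_X ^ (i * ?e + c) dvd a \<Longrightarrow> a \<in> mpow R i" using mpow_conductor by blast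
  \<comment> \<open>i e + K = (i+1) e + c, the order from which everything lies in m^(i+1).\<close>
  define K where "K = ?e + c"
  have K: "K > 0" using mult_e_pos by (simp add: K_def)
  have cK: "a \<in> mpow R (Suc i)" if "fps_X ^ (i * ?e + K) dvd a" for i a
    using c[of "Suc i" a] that by (simp add: K_def add_ac)
  \<comment> \<open>The degree is i = \<open>n div K\<close>. As \<open>n mod K\<close> runs from 0
    to K - 1, the required order falls from i e + K, which leaves only the zero class in degree i,
    to i e + 1.\<close>
  define P where "P n = filt (n div K) ((n div K) * ?e + (K - n mod K))" for n
  define F where "F n = gr_proj ` {p \<in> rees. P n p}" for n
  have mem_F: "gr_proj p \<in> F n \<longleftrightarrow> P n p" if "p \<in> rees" for p n
  proof
    assume "gr_proj p \<in> F n"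
    then obtain q where "P n q" "gr_proj p = gr_proj q" unfolding F_def by blast
    then show "P n p" unfolding P_def using filt_ker_add by (simp add: gr_proj_eq_iff)
  qed (use that in \<open>simp add: F_def\<close>)
  have filt_full: "filt i (i * ?e) p \<longleftrightarrow> (\<forall>l>i. coeff p l \<in> mpow R (Suc l))" if "p \<in> rees" for i p
    using that mpow_dvd mpow_zero[of "Suc i"] unfolding filt_def rees_def
    by (metis (no_types, lifting) diff_self mem_Collect_eq)
  have filt_trivial: "filt i (i * ?e + K) p \<longleftrightarrow> (\<forall>l\<ge>i. coeff p l \<in> mpow R (Suc l))" for i p
  proof
    assume L: "filt i (i * ?e + K) p"
    then obtain a where a: "fps_X ^ (i * ?e + K) dvd a" "coeff p i - a \<in> mpow R (Suc i)"
      by (auto simp: filt_def)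
    have "coeff p i \<in> mpow R (Suc i)" using mpow_add[OF a(2) cK[OF a(1)]] by (simp del: mpow.simps)
    then show "\<forall>l\<ge>i. coeff p l \<in> mpow R (Suc l)" using L
      by (metis filt_def le_neq_implies_less)
  next
    assume R: "\<forall>l\<ge>i. coeff p l \<in> mpow R (Suc l)"
    then have "coeff p i - 0 \<in> mpow R (Suc i)" by (simp del: mpow.simps)
    then show "filt i (i * ?e + K) p" using R unfolding filt_def by (meson dvd_0_right less_imp_le)
  qed
  \<comment> \<open>At the end of a block the required order drops to i e, no condition on m^i,
    which agrees with the start of the block of degree i + 1.\<close>
  have P_Suc: "P (Suc n) p \<longleftrightarrow> filt (n div K) ((n div K) * ?e + (K - Suc (n mod K))) p"
    if p: "p \<in> rees" for n p
  proof (cases "Suc (n mod K) = K")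
    case True
    then have "Suc n div K = Suc (n div K)" "Suc n mod K = 0"
      by (simp_all add: div_Suc mod_Suc)
    moreover from True have "K - Suc (n mod K) = 0" by simp
    ultimately show ?thesis unfolding P_def
      by (simp only: diff_zero add_0_right filt_trivial filt_full[OF p] Suc_le_eq)
  next
    case False
    then have "Suc n div K = n div K" "Suc n mod K = Suc (n mod K)"
      by (simp_all add: div_Suc mod_Suc)
    then show ?thesis by (simp add: P_def)
  qed
  have P_shift: "P (n + K) (monom x (Suc 0) * p) \<longleftrightarrow> P n p"
    if "p \<in> rees" "N * K \<le> n" for n p
  proof -
    have Ni: "N \<le> n div K" using that(2) K by (simp add: less_eq_div_iff_mult_less_eq)
    have "(n + K) div K = Suc (n div K)" "(n + K) mod K = n mod K" using K by simp_all
    then show ?thesis unfolding P_def using filt_x_mult_iff[OF that(1) Ni] by (simp add: add.assoc)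
  qed
  show ?thesis
  proof (rule G.noetherian_ring_filtration[where F = F and K = K and X = "gr_proj (monom x (Suc 0))"
        and B = "N * K", OF _ _ K])
    have "P 0 p \<longleftrightarrow> p \<in> rees_ker" for p
      using filt_trivial[of 0 p] by (simp add: P_def rees_ker_def)
    then show "F 0 = {\<zero>\<^bsub>gr_ring R\<^esub>}"
      using rees_0 by (auto simp: F_def gr_zero gr_proj_eq_iff image_iff) (force simp: rees_ker_def mpow_zero simp del: mpow.simps)
    show "carrier (gr_ring R) = (\<Union>n. F n)"
    proof
      show "carrier (gr_ring R) \<subseteq> (\<Union>n. F n)"
      proof
        fix u assume "u \<in> carrier (gr_ring R)"
        then obtain p where p: "u = gr_proj p" "p \<in> rees" by (auto simp: gr_carrier_simp)
        have "filt (Suc (degree p)) (Suc (degree p) * ?e + K) p"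
          unfolding filt_trivial using mpow_zero
          by (intro allI impI) (simp add: coeff_eq_0 del: mpow.simps)
        then have "P (Suc (degree p) * K) p" using K unfolding P_def by simp
        then show "u \<in> (\<Union>n. F n)" using p mem_F by blast
      qed
    qed (auto simp: F_def gr_carrier_simp)
    show "gr_proj (monom x (Suc 0)) \<in> carrier (gr_ring R)" by (simp add: gr_carrier_simp x_rees)
    show "gr_proj (monom x (Suc 0)) \<otimes>\<^bsub>gr_ring R\<^esub> z \<in> F (n + K) \<longleftrightarrow> z \<in> F n"
      if "N * K \<le> n" "z \<in> carrier (gr_ring R)" for n z
      using that P_shift by (auto simp: gr_carrier_simp gr_mult x_rees mem_F rees_mult)
    show "\<exists>v\<in>carrier (gr_ring R). y \<ominus>\<^bsub>gr_ring R\<^esub> v \<otimes>\<^bsub>gr_ring R\<^esub> z \<in> F n"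
      if y: "y \<in> F (Suc n)" and z: "z \<in> F (Suc n)" "z \<notin> F n" for n y z
    proof -
      let ?i = "n div K"
      define d where "d = ?i * ?e + (K - Suc (n mod K))"
      have d: "Suc d = ?i * ?e + (K - n mod K)"
        using mod_less_divisor[OF K, of n] by (simp add: d_def)
      obtain p where p: "y = gr_proj p" "p \<in> rees" using y by (auto simp: F_def)
      obtain q where q: "z = gr_proj q" "q \<in> rees" using z by (auto simp: F_def)
      have fp: "filt ?i d p" and fq: "filt ?i d q"
        using y z P_Suc p q mem_F by (simp_all add: d_def)
      have nfq: "\<not> filt ?i (Suc d) q" using z(2) q mem_F by (simp add: P_def d)
      obtain a where a: "fps_X ^ d dvd a" "coeff p ?i - a \<in> mpow R (Suc ?i)" using fp by (auto simp: filt_def)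
      obtain b where b: "fps_X ^ d dvd b" "coeff q ?i - b \<in> mpow R (Suc ?i)" using fq by (auto simp: filt_def)
      have bd: "fps_nth b d \<noteq> 0"
      proof
        assume "fps_nth b d = 0"
        then have "fps_X ^ Suc d dvd b" using b(1) unfolding fps_X_power_dvd_iff by (auto simp: less_Suc_eq)
        then show False using nfq fq b(2) unfolding filt_def by blast
      qed
      \<comment> \<open>The quotient of the coefficients at order \<open>d\<close>: subtracting r q
        removes that coefficient and so moves one step down the filtration.\<close>
      define r where "r = fps_const (fps_nth a d / fps_nth b d)"
      have rR: "[:r:] \<in> rees" using rees_monom[of r 0] constants by (simp add: r_def monom_0)
      have ri: "coeff (p - [:r:] * q) l = coeff p l - r * coeff q l" for l
        by simp
      have "fps_X ^ Suc d dvd a - r * b"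
        using a(1) b(1) bd unfolding fps_X_power_dvd_iff by (auto simp: less_Suc_eq r_def)
      moreover have "coeff (p - [:r:] * q) ?i - (a - r * b) \<in> mpow R (Suc ?i)"
      proof -
        have "(coeff p ?i - a) - r * (coeff q ?i - b) \<in> mpow R (Suc ?i)"
          by (intro mpow_diff a b mpow_smult) (simp add: r_def constants)
        then show ?thesis by (simp add: algebra_simps del: mpow.simps)
      qed
      moreover have "coeff (p - [:r:] * q) l \<in> mpow R (Suc l)" if "l > ?i" for l
        unfolding ri using fp fq that
        by (intro mpow_diff mpow_smult) (auto simp: r_def constants filt_def simp del: mpow.simps)
      ultimately have "P n (p - [:r:] * q)" unfolding P_def d[symmetric] filt_def by blast
      then have "gr_proj (p - [:r:] * q) \<in> F n"
        using mem_F rees_diff[OF p(2) rees_mult[OF rR q(2)]] by blast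
      then show ?thesis using p q rR
        by (intro bexI[of _ "gr_proj [:r:]"]) (auto simp: gr_mult gr_minus gr_carrier_simp rees_mult simp del: mult_pCons_left)
    qed
  qed
qed

text \<open>Replacing \<open>w\<close> by the explicit lift \<open>p\<close> of its image stays
  inside \<open>M\<close>, as the difference is in the kernel. For \<open>q\<close> nonzero in
  gr(R), the lowest component of \<open>p * q\<close> is a nonzero constant times
  \<open>x ^ r\<close> times the lowest component of \<open>q\<close>, and regularity of the initial
  form keeps it nonzero.\<close>

lemma ex_nonzerodivisor_of_regular:
  assumes reg: "\<And>i a. \<lbrakk>a \<in> mpow R i; x * a \<in> mpow R (Suc (Suc i))\<rbrakk> \<Longrightarrow> a \<in> mpow R (Suc i)"
    and M: "maximalideal M (gr_ring R)"
  shows "\<exists>z \<in> M. \<forall>y \<in> carrier (gr_ring R). z \<otimes>\<^bsub>gr_ring R\<^esub> y = \<zero>\<^bsub>gr_ring R\<^esub> \<longrightarrow> y = \<zero>\<^bsub>gr_ring R\<^esub>"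
proof -
  interpret Q: poly_quotient "gr_ring R" gr_lead by (rule poly_quotient_gr)
  interpret M: maximalideal M "gr_ring R" by (rule M)
  obtain w where w: "w \<in> M" "gr_lead w \<noteq> 0" using Q.maximalideal_not_in_kernel[OF M] by blast
  then obtain p where p: "p \<in> rees" "rees_lead p = gr_lead w"
    and px: "\<And>i. \<exists>c. coeff p i = fps_const c * x ^ i \<and> (c = 0 \<longleftrightarrow> coeff (gr_lead w) i = 0)"
    using rees_lead_surj[OF x_mideal x_nonzero subdegree_x, of "gr_lead w"] by blast
  have pc: "gr_proj p \<in> carrier (gr_ring R)" using p by (simp add: gr_carrier_simp)
  have wc: "w \<in> carrier (gr_ring R)" using w M.Icarr by blast
  have "gr_lead (gr_proj p \<ominus>\<^bsub>gr_ring R\<^esub> w) = 0"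
    using p pc wc by (simp add: Q.phi_minus gr_lead_gr_proj)
  then have "gr_proj p \<ominus>\<^bsub>gr_ring R\<^esub> w \<in> M"
    using Q.kernel_subset_primeideal[OF Q.maximalideal_prime[OF M]] pc wc by auto
  then have "(gr_proj p \<ominus>\<^bsub>gr_ring R\<^esub> w) \<oplus>\<^bsub>gr_ring R\<^esub> w \<in> M" using w by simp
  then have pM: "gr_proj p \<in> M" using pc wc by (simp add: a_minus_def Q.a_assoc Q.l_neg)
  have reg_pow: "a \<in> mpow R (Suc i)" if "a \<in> mpow R i" "x ^ r * a \<in> mpow R (Suc (r + i))" for r i a
    using that
  proof (induction r)
    case (Suc r)
    have "x ^ r * a \<in> mpow R (r + i)"
      by (rule mpow_mult[OF mpow_power[OF x_mideal] Suc.prems(1)])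
    then have "x ^ r * a \<in> mpow R (Suc (r + i))"
      using reg Suc.prems(2) by (simp add: mult.assoc del: mpow.simps)
    then show ?case using Suc.IH Suc.prems(1) by blast
  qed simp
  have "q \<in> rees_ker" if q: "q \<in> rees" "p * q \<in> rees_ker" for q
  proof (rule ccontr)
    assume "q \<notin> rees_ker"
    then have ex_s: "\<exists>s. coeff q s \<notin> mpow R (Suc s)" by (auto simp: rees_ker_def)
    define s where "s = (LEAST s. coeff q s \<notin> mpow R (Suc s))"
    have s: "coeff q s \<notin> mpow R (Suc s)" unfolding s_def using ex_s by (rule LeastI_ex)
    have s_min: "coeff q l \<in> mpow R (Suc l)" if "l < s" for l
      using not_less_Least[OF that[unfolded s_def]] by blast
    have "p \<noteq> 0"
    proof
      assume "p = 0"
      then have "rees_lead p = 0" by (simp add: poly_eq_iff coeff_rees_lead)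
      then show False using p(2) w(2) by simp
    qed
    then have ex_r: "\<exists>r. coeff p r \<noteq> 0" by (auto simp: poly_eq_iff)
    define r where "r = (LEAST r. coeff p r \<noteq> 0)"
    have r: "coeff p r \<noteq> 0" unfolding r_def using ex_r by (rule LeastI_ex)
    have r_min: "coeff p l = 0" if "l < r" for l
      using not_less_Least[OF that[unfolded r_def]] by blast
    obtain c where c: "coeff p r = fps_const c * x ^ r" using px by blast
    then have c0: "c \<noteq> 0" using r by auto
    have "coeff (p * q) (r + s) = (\<Sum>i\<le>r + s. coeff p i * coeff q (r + s - i))" by (simp add: coeff_mult)
    also have "\<dots> = coeff p r * coeff q s + (\<Sum>i\<in>{..r + s} - {r}. coeff p i * coeff q (r + s - i))"
      by (subst sum.remove[of _ r]) auto
    finally have split: "coeff p r * coeff q s =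
      coeff (p * q) (r + s) - (\<Sum>i\<in>{..r + s} - {r}. coeff p i * coeff q (r + s - i))" by simp
    have "coeff p i * coeff q (r + s - i) \<in> mpow R (Suc (r + s))" if i: "i \<in> {..r + s} - {r}" for i
    proof (cases "i < r")
      case False
      then have "coeff q (r + s - i) \<in> mpow R (Suc (r + s - i))" using i by (intro s_min) auto
      moreover have "coeff p i \<in> mpow R i" using p(1) by (simp add: rees_def)
      moreover have "Suc (r + s) = i + Suc (r + s - i)" using i by simp
      ultimately show ?thesis using mpow_mult by metis
    qed (simp add: r_min mpow_zero del: mpow.simps)
    then have "coeff p r * coeff q s \<in> mpow R (Suc (r + s))"
      unfolding split using q(2) by (intro mpow_diff mpow_sum) (auto simp: rees_ker_def simp del: mpow.simps)
    then have "fps_const (inverse c) * (coeff p r * coeff q s) \<in> mpow R (Suc (r + s))"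
      by (rule mpow_smult) (rule constants)
    moreover have "fps_const (inverse c) * (coeff p r * coeff q s) = x ^ r * coeff q s"
      using c0 by (simp add: c mult.assoc[symmetric])
    ultimately have "coeff q s \<in> mpow R (Suc s)"
      using reg_pow[of "coeff q s" s r] q(1) by (simp add: rees_def del: mpow.simps)
    then show False using s by blast
  qed
  then show ?thesis using gr_nonzerodivisor_iff[OF p(1)] pM by blast
qed

text \<open>Some power of a nonzerodivisor in the irrelevant ideal is a multiple of the initial form
  of \<open>x\<close>; whatever the initial form kills is then killed by that power, hence
  zero.\<close>

lemma regular_of_nonzerodivisor:
  assumes M: "\<And>M. maximalideal M (gr_ring R) \<Longrightarrow>
      \<exists>z \<in> M. \<forall>y \<in> carrier (gr_ring R). z \<otimes>\<^bsub>gr_ring R\<^esub> y = \<zero>\<^bsub>gr_ring R\<^esub> \<longrightarrow> y = \<zero>\<^bsub>gr_ring R\<^esub>"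
    and a: "a \<in> mpow R i" "x * a \<in> mpow R (Suc (Suc i))"
  shows "a \<in> mpow R (Suc i)"
proof -
  interpret Q: poly_quotient "gr_ring R" gr_lead by (rule poly_quotient_gr)
  obtain z where z: "z \<in> carrier (gr_ring R)" "[:0, 1:] dvd gr_lead z"
    and zreg: "\<forall>y \<in> carrier (gr_ring R). z \<otimes>\<^bsub>gr_ring R\<^esub> y = \<zero>\<^bsub>gr_ring R\<^esub> \<longrightarrow> y = \<zero>\<^bsub>gr_ring R\<^esub>"
    using M[OF Q.maximalideal_dvd_X] by blast
  obtain p where p: "z = gr_proj p" "p \<in> rees" using z(1) by (auto simp: gr_carrier_simp)
  have preg: "q \<in> rees_ker" if "q \<in> rees" "p * q \<in> rees_ker" for q
    using zreg gr_nonzerodivisor_iff[OF p(2)] that p(1) by blast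
  have "poly (rees_lead p) 0 = 0" using z(2) p by (simp add: gr_lead_gr_proj poly_eq_0_iff_dvd)
  then have "fps_nth (coeff p 0) 0 = 0" by (simp add: poly_0_coeff_0 coeff_rees_lead)
  moreover have "coeff p 0 \<in> R" using p(2) mpow_subset by (auto simp: rees_def)
  ultimately have p0: "coeff p 0 \<in> mpow R (Suc 0)" using mpow_1 by (auto simp: mideal_def)
  \<comment> \<open>The degree-zero coefficient lies in m, so removing it does not change the class
    in gr(R) and makes the polynomial divisible by its variable.\<close>
  define p' where "p' = p - [:coeff p 0:]"
  have "monom (coeff p 0) 0 \<in> rees_ker"
    using p0 by (auto simp: rees_ker_def mpow_zero simp del: mpow.simps)
  then have k0: "[:coeff p 0:] \<in> rees_ker" by (simp add: monom_0)
  have c0: "[:coeff p 0:] \<in> rees"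
    using rees_monom[of "coeff p 0" 0] \<open>coeff p 0 \<in> R\<close> by (simp add: monom_0)
  have p'R: "p' \<in> rees" unfolding p'_def by (rule rees_diff[OF p(2) c0])
  have p'reg: "q \<in> rees_ker" if q: "q \<in> rees" "p' * q \<in> rees_ker" for q
  proof -
    have "p' * q + q * [:coeff p 0:] \<in> rees_ker"
      by (rule rees_ker_add[OF q(2) rees_ker_mult[OF q(1) k0]])
    then have "p * q \<in> rees_ker" by (simp add: p'_def algebra_simps)
    then show ?thesis using preg q by blast
  qed
  have p'pow: "q \<in> rees_ker" if "q \<in> rees" "p' ^ n * q \<in> rees_ker" for n q
    using that
  proof (induction n)
    case (Suc n)
    then show ?case using p'reg[of "p' ^ n * q"] p'R by (simp add: rees_mult rees_power mult.assoc)
  qed simp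
  have "coeff p' 0 = 0" by (simp add: p'_def)
  then have "poly p' 0 = 0" by (simp add: poly_0_coeff_0)
  then obtain r where "p' = [:0, 1:] * r" by (auto simp: poly_eq_0_iff_dvd)
  then have "p' ^ Suc N = [:0, 1:] ^ Suc N * r ^ Suc N" by (simp only: power_mult_distrib)
  also have "[:0, 1:] ^ Suc N = (monom 1 (Suc N) :: 'a fps poly)" by (simp add: monom_altdef)
  finally have low: "coeff (p' ^ Suc N) i = 0" if "i < Suc N" for i
    using that by (simp add: coeff_monom_mult del: power_Suc)
  have pR: "p' ^ Suc N \<in> rees" by (rule rees_power[OF p'R])
  \<comment> \<open>The exponent N + 1 empties the degrees up to \<open>N\<close>; in a degree i + 1
    above \<open>N\<close> the coefficient lies in m^(i+1) = x m^i.\<close>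
  have "\<exists>b. b \<in> mpow R i \<and> coeff (p' ^ Suc N) (Suc i) = x * b" for i
  proof (cases "N \<le> i")
    case True
    have "coeff (p' ^ Suc N) (Suc i) \<in> mpow R (Suc i)"
      using pR unfolding rees_def by blast
    then show ?thesis using reduction[OF True] by blast
  next
    case False
    then show ?thesis using low[of "Suc i"] mpow_zero[of i] by (intro exI[of _ 0]) auto
  qed
  then obtain b where b: "\<And>i. b i \<in> mpow R i" "\<And>i. coeff (p' ^ Suc N) (Suc i) = x * b i" by metis
  define q where "q = Abs_poly b"
  have cq: "coeff q = b"
    unfolding q_def
  proof (rule coeff_Abs_poly)
    fix i assume "degree (p' ^ Suc N) < i"
    then have "x * b i = 0" unfolding b(2)[symmetric] by (intro coeff_eq_0) simp
    then show "b i = 0" using x_nonzero by simp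
  qed
  have qR: "q \<in> rees" by (simp add: rees_def cq b)
  have pq: "p' ^ Suc N = monom x (Suc 0) * q"
  proof (rule poly_eqI)
    fix i show "coeff (p' ^ Suc N) i = coeff (monom x (Suc 0) * q) i"
      using b(2)[of "i - 1"] low[of 0] by (cases i) (simp_all add: coeff_x_mult cq)
  qed
  have "p' ^ Suc N * monom a i = q * monom (x * a) (Suc i)"
    unfolding pq by (simp add: mult_monom algebra_simps)
  also have "monom (x * a) (Suc i) \<in> rees_ker"
    using a(2) by (auto simp: rees_ker_def mpow_zero simp del: mpow.simps)
  then have "q * monom (x * a) (Suc i) \<in> rees_ker" by (rule rees_ker_mult[OF qR])
  finally have "monom a i \<in> rees_ker" by (rule p'pow[OF rees_monom[OF a(1)]])
  then have "coeff (monom a i) i \<in> mpow R (Suc i)" unfolding rees_ker_def by blast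
  then show ?thesis by (simp del: mpow.simps)
qed

theorem cohen_macaulay_gr_iff:
  "cohen_macaulay (gr_ring R) \<longleftrightarrow>
    (\<forall>i. \<forall>a \<in> mpow R i. x * a \<in> mpow R (Suc (Suc i)) \<longrightarrow> a \<in> mpow R (Suc i))"
proof -
  interpret Q: poly_quotient "gr_ring R" gr_lead by (rule poly_quotient_gr)
  show ?thesis
    unfolding Q.cohen_macaulay_iff
    using noetherian_ring_gr ex_nonzerodivisor_of_regular regular_of_nonzerodivisor by blast
qed

end

section \<open>The BF condition\<close>

lemma fps_X_power_dvd_fps_X_power_iff:
  "(fps_X :: 'a::field fps) ^ m dvd fps_X ^ n \<longleftrightarrow> m \<le> n"
  by (simp add: fps_dvd_iff)

lemma fps_compose_nonzero:
  fixes g x :: "'a::field fps"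
  assumes "g \<noteq> 0" "x \<noteq> 0" "fps_nth x 0 = 0"
  shows "fps_compose g x \<noteq> 0" "subdegree (fps_compose g x) = subdegree g * subdegree x"
proof -
  define u where "u = fps_compose (fps_shift (subdegree g) g) x"
  have "g = fps_shift (subdegree g) g * fps_X ^ subdegree g" by (rule subdegree_decompose)
  then have "fps_compose g x = u * x ^ subdegree g"
    using assms(3) unfolding u_def
    by (metis fps_compose_mult_distrib fps_compose_power fps_X_fps_compose_startby0)
  moreover have "fps_nth u 0 \<noteq> 0" using assms(1) by (simp add: u_def)
  then have "u \<noteq> 0" "subdegree u = 0" by auto
  ultimately show "fps_compose g x \<noteq> 0" "subdegree (fps_compose g x) = subdegree g * subdegree x"
    using assms(2) by (auto simp: subdegree_power)
qed

lemma bounded_incseq_nat_stable: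
  fixes s :: "nat \<Rightarrow> nat"
  assumes "\<And>i. s i \<le> s (Suc i)" "\<And>i. s i \<le> B"
  shows "\<exists>N. \<forall>i\<ge>N. s (Suc i) = s i"
proof -
  obtain N where N: "\<And>i. s i \<le> s N"
    using ex_has_greatest_nat[of "\<lambda>_. True" 0 s "Suc B"] assms(2) by (auto simp: less_Suc_eq_le)
  have "s N \<le> s i" if "N \<le> i" for i
    by (rule lift_Suc_mono_le[of s, OF assms(1) that])
  then show ?thesis using N by (metis le_SucI le_antisym)
qed

text \<open>Both sides say that \<open>H\<close> stays 0 up to some b and then rises at every step.
  If N - H N = b, then \<open>H\<close> climbs from 0 at b to N - b at \<open>N\<close> in steps of
  at most one, which leaves no room for a zero step; after \<open>N\<close> there is none by
  \<open>ev\<close>.\<close>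

lemma stable_iff_no_second_plateau:
  fixes H :: "nat \<Rightarrow> nat"
  assumes H0: "H 0 = 0" and mono: "\<And>i. H i \<le> H (Suc i)" and step: "\<And>i. H (Suc i) \<le> Suc (H i)"
    and ev: "\<And>i. N \<le> i \<Longrightarrow> H (Suc i) = Suc (H i)"
  shows "N - H N = (GREATEST i. H i = 0) \<longleftrightarrow>
    (\<forall>i. H (Suc i) = Suc (H i) \<longrightarrow> H (Suc (Suc i)) = Suc (H (Suc i)))"
proof -
  have mono': "H i \<le> H k" if "i \<le> k" for i k using lift_Suc_mono_le[of H, OF mono that] .
  have step': "H k \<le> H i + (k - i)" if "i \<le> k" for i k
    using that
  proof (induction k rule: dec_induct)
    case (step k)
    then show ?case using assms(3)[of k] by linarith
  qed simp
  have bound: "i \<le> N" if "H i = 0" for i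
  proof (rule ccontr)
    assume "\<not> i \<le> N"
    then show False using ev[of N] mono'[of "Suc N" i] that by simp
  qed
  define b where "b = (GREATEST i. H i = 0)"
  have b: "H b = 0" unfolding b_def by (rule GreatestI_nat[of _ 0 N]) (use H0 bound in auto)
  have "H (Suc b) \<noteq> 0"
  proof
    assume "H (Suc b) = 0"
    then have "Suc b \<le> b" unfolding b_def using bound by (intro Greatest_le_nat[of _ _ N]) auto
    then show False by simp
  qed
  then have Sb: "H (Suc b) = Suc (H b)" using b step[of b] by simp
  have bN: "b \<le> N" using bound b by blast
  have "N - H N = b \<longleftrightarrow> (\<forall>i. H (Suc i) = Suc (H i) \<longrightarrow> H (Suc (Suc i)) = Suc (H (Suc i)))"
  proof
    assume eq: "N - H N = b"
    have HN: "H N \<le> N" using step'[of 0 N] H0 by simp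
    have Hi: "H i = i - b" if "b \<le> i" "i \<le> N" for i
      using step'[OF that(1)] step'[OF that(2)] b eq HN that by linarith
    have "H (Suc i) = Suc (H i)" if "b \<le> i" for i
      using Hi[of i] Hi[of "Suc i"] ev[of i] that by (cases "N \<le> i") auto
    moreover have "b \<le> i" if "H (Suc i) = Suc (H i)" for i
      using mono'[of "Suc i" b] b that by (cases "b \<le> i") auto
    ultimately show "\<forall>i. H (Suc i) = Suc (H i) \<longrightarrow> H (Suc (Suc i)) = Suc (H (Suc i))"
      by (meson le_SucI)
  next
    assume R: "\<forall>i. H (Suc i) = Suc (H i) \<longrightarrow> H (Suc (Suc i)) = Suc (H (Suc i))"
    have inc: "H (Suc (b + k)) = Suc (H (b + k))" for k
      by (induction k) (use Sb R in auto)
    have "H (b + k) = k" for k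
      by (induction k) (use b inc in auto)
    from this[of "N - b"] show "N - H N = b" using bN by simp
  qed
  then show ?thesis by (simp add: b_def)
qed

context fps_subalgebra
begin

lemma w_elt_mod: "w_elt R j mod mult_e R = j mod mult_e R"
proof -
  obtain c where "\<forall>n\<ge>c. n \<in> valset R" using ex_value by blast
  moreover have "c \<le> j + c * mult_e R" using mult_e_pos by (cases "mult_e R") auto
  ultimately have "j + c * mult_e R \<in> valset R \<and> (j + c * mult_e R) mod mult_e R = j mod mult_e R"
    by simp
  then have "w_elt R j \<in> valset R \<and> w_elt R j mod mult_e R = j mod mult_e R"
    unfolding w_elt_def by (rule LeastI)
  then show ?thesis by simp
qed

end

context fps_subalgebra_reduction
begin

lemma x_power_mult_iff: "N \<le> i \<Longrightarrow> x ^ n * a \<in> mpow R (n + i) \<longleftrightarrow> a \<in> mpow R i"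
  by (induction n) (simp_all add: mult.assoc x_mult_iff del: mpow.simps)

text \<open>In effect R' = x^(-N) m^N. If \<open>u\<close> preserves m^n it preserves all higher
  powers; applied to x^(n+N), with x^n cancelled, this gives one direction. The other cancels x^N
  from a product in m^(2N).\<close>

lemma blowup_iff: "u \<in> blowup R \<longleftrightarrow> x ^ N * u \<in> mpow R N"
proof
  assume "u \<in> blowup R"
  then obtain n where n: "\<And>y. y \<in> mpow R n \<Longrightarrow> u * y \<in> mpow R n" by (auto simp: blowup_def)
  have nk: "u * y \<in> mpow R (n + k)" if "y \<in> mpow R (n + k)" for k y
    using that
  proof (induction k arbitrary: y)
    case (Suc k)
    from Suc.prems have "y \<in> ideal_prod (mpow R (n + k)) (mideal R)" by simp
    then show ?case
    proof induction
      case (step a b v)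
      have "u * a * b + u * v \<in> mpow R (n + Suc k)"
        using mpow_mult_mideal[OF Suc.IH[OF step(1)] step(2)] step by (intro mpow_add) simp_all
      then show ?case by (simp add: algebra_simps)
    qed (simp add: mpow_zero del: mpow.simps)
  qed (use n in simp)
  have "u * x ^ (n + N) \<in> mpow R (n + N)" by (rule nk[OF mpow_power[OF x_mideal]])
  then have "x ^ n * (x ^ N * u) \<in> mpow R (n + N)" by (simp add: power_add algebra_simps)
  then show "x ^ N * u \<in> mpow R N" by (simp add: x_power_mult_iff)
next
  assume u: "x ^ N * u \<in> mpow R N"
  have "u * y \<in> mpow R N" if "y \<in> mpow R N" for y
  proof -
    have "x ^ N * (u * y) \<in> mpow R (N + N)" using mpow_mult[OF u that] by (simp add: mult.assoc)
    then show ?thesis by (simp add: x_power_mult_iff)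
  qed
  then show "u \<in> blowup R" by (auto simp: blowup_def)
qed

end

locale fps_BF = fps_subalgebra +
  fixes x :: "'a fps" and f :: "nat \<Rightarrow> 'a fps" and h :: "nat \<Rightarrow> nat \<Rightarrow> nat"
  assumes x: "x \<in> R" "x \<noteq> 0" "subdegree x = mult_e R"
    and f: "j < mult_e R \<Longrightarrow> f j \<in> R" "j < mult_e R \<Longrightarrow> f j \<noteq> 0"
      "j < mult_e R \<Longrightarrow> subdegree (f j) = w_elt R j"
    and span: "mpow R i = {(\<Sum>j < mult_e R. fps_compose (g j) x * x ^ h i j * f j) | g. True}"
    and free: "\<lbrakk>(\<Sum>j < mult_e R. fps_compose (g j) x * x ^ h i j * f j) = 0; j < mult_e R\<rbrakk> \<Longrightarrow> g j = 0"
begin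

section \<open>Coordinates with respect to the BF basis\<close>

lemma x0: "fps_nth x 0 = 0"
  using mult_e_pos x by (intro nth_less_subdegree_zero) simp

lemma x_mideal': "x \<in> mideal R"
  using x x0 by (simp add: mideal_def)

text \<open>One coordinate system for all powers of m: the exponents leave the basis and turn into
  divisibility of the coordinates by powers of the variable.\<close>

definition lincomb :: "(nat \<Rightarrow> 'a fps) \<Rightarrow> 'a fps" where
  "lincomb G = (\<Sum>j < mult_e R. fps_compose (G j) x * f j)"

lemma compose_X_power_mult: "fps_compose (G * fps_X ^ n) x = fps_compose G x * x ^ n"
  using x0 by (metis fps_compose_mult_distrib fps_compose_power fps_X_fps_compose_startby0)

lemma lincomb_X_power: "lincomb (\<lambda>j. G j * fps_X ^ k j) = (\<Sum>j < mult_e R. fps_compose (G j) x * x ^ k j * f j)"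
  by (simp add: lincomb_def compose_X_power_mult)

lemma mpow_lincomb: "mpow R i = {lincomb G | G. \<forall>j < mult_e R. fps_X ^ h i j dvd G j}"
proof
  show "mpow R i \<subseteq> {lincomb G | G. \<forall>j < mult_e R. fps_X ^ h i j dvd G j}"
  proof
    fix a assume "a \<in> mpow R i"
    then obtain g where "a = lincomb (\<lambda>j. g j * fps_X ^ h i j)"
      unfolding span[of i] lincomb_X_power by blast
    then show "a \<in> {lincomb G | G. \<forall>j < mult_e R. fps_X ^ h i j dvd G j}" by force
  qed
  show "{lincomb G | G. \<forall>j < mult_e R. fps_X ^ h i j dvd G j} \<subseteq> mpow R i"
  proof
    fix a assume "a \<in> {lincomb G | G. \<forall>j < mult_e R. fps_X ^ h i j dvd G j}"
    then obtain G where G: "a = lincomb G" "\<forall>j < mult_e R. fps_X ^ h i j dvd G j" by blast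
    from G(2) have "\<forall>j. \<exists>g. j < mult_e R \<longrightarrow> G j = g * fps_X ^ h i j"
      by (metis dvdE mult.commute)
    then obtain g where "\<And>j. j < mult_e R \<Longrightarrow> G j = g j * fps_X ^ h i j" by metis
    then have "lincomb G = lincomb (\<lambda>j. g j * fps_X ^ h i j)" by (simp add: lincomb_def)
    then show "a \<in> mpow R i" unfolding span[of i] lincomb_X_power G(1) by blast
  qed
qed

lemma lincomb_eq_0: "lincomb G = 0 \<Longrightarrow> j < mult_e R \<Longrightarrow> G j = 0"
proof -
  assume G: "lincomb G = 0" and j: "j < mult_e R"
  \<comment> \<open>\<open>h 0 j = 0\<close> is itself deduced through this lemma, so the exponents
    of the given basis of m^0 are absorbed by multiplying with a common power
    \<open>x ^ M\<close>.\<close>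
  define M where "M = Max (h 0 ` {..<mult_e R})"
  have M: "h 0 j \<le> M" if "j < mult_e R" for j unfolding M_def using that by (intro Max_ge) auto
  have "(\<Sum>j < mult_e R. fps_compose (G j * fps_X ^ (M - h 0 j)) x * x ^ h 0 j * f j)
      = (\<Sum>j < mult_e R. x ^ M * (fps_compose (G j) x * f j))"
  proof (rule sum.cong)
    fix j assume "j \<in> {..<mult_e R}"
    then have "x ^ (M - h 0 j) * x ^ h 0 j = x ^ M" using M by (simp flip: power_add)
    then show "fps_compose (G j * fps_X ^ (M - h 0 j)) x * x ^ h 0 j * f j
        = x ^ M * (fps_compose (G j) x * f j)"
      by (metis compose_X_power_mult mult.assoc mult.left_commute)
  qed simp
  also have "\<dots> = x ^ M * lincomb G" by (simp add: lincomb_def sum_distrib_left)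
  finally have "G j * fps_X ^ (M - h 0 j) = 0"
    using free[of "\<lambda>j. G j * fps_X ^ (M - h 0 j)" 0 j] G j by simp
  then show "G j = 0" by simp
qed

lemma lincomb_diff: "lincomb G - lincomb G' = lincomb (\<lambda>j. G j - G' j)"
  by (simp add: lincomb_def fps_compose_sub_distrib left_diff_distrib sum_subtractf)

lemma lincomb_mem_iff: "lincomb G \<in> mpow R i \<longleftrightarrow> (\<forall>j < mult_e R. fps_X ^ h i j dvd G j)"
proof
  assume "lincomb G \<in> mpow R i"
  then obtain G' where G': "lincomb G = lincomb G'" "\<forall>j < mult_e R. fps_X ^ h i j dvd G' j"
    unfolding mpow_lincomb by blast
  have "G j = G' j" if "j < mult_e R" for j
    using lincomb_eq_0[of "\<lambda>j. G j - G' j" j] G'(1) that by (simp flip: lincomb_diff)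
  then show "\<forall>j < mult_e R. fps_X ^ h i j dvd G j" using G'(2) by simp
qed (auto simp: mpow_lincomb)

lemma x_mult_lincomb: "x * lincomb G = lincomb (\<lambda>j. G j * fps_X)"
  using compose_X_power_mult[of _ 1] by (simp add: lincomb_def sum_distrib_left mult.left_commute mult.commute[of _ x] mult.assoc)

lemma x_power_f: "j < mult_e R \<Longrightarrow> x ^ n * f j = lincomb (\<lambda>l. if l = j then fps_X ^ n else 0)"
  unfolding lincomb_def using compose_X_power_mult[of 1 n]
  by (subst sum.remove[of _ j]) auto

text \<open>This makes \<open>h i j\<close> the least exponent bringing \<open>f j\<close> into m^i.
  Its shape then follows from inclusions: m^(i+1) in m^i gives monotonicity, x m^i in m^(i+1) bounds
  each step by one.\<close>

lemma x_power_f_mem_iff: "j < mult_e R \<Longrightarrow> x ^ n * f j \<in> mpow R i \<longleftrightarrow> h i j \<le> n"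
  by (auto simp: x_power_f lincomb_mem_iff fps_X_power_dvd_fps_X_power_iff)

lemma h_0: "j < mult_e R \<Longrightarrow> h 0 j = 0"
  using x_power_f_mem_iff[of j 0 0] f by simp

lemma h_mono: "j < mult_e R \<Longrightarrow> h i j \<le> h (Suc i) j"
  using x_power_f_mem_iff[of j "h (Suc i) j"] mpow_Suc_subset[of i] by blast

lemma h_Suc:
  assumes j: "j < mult_e R"
  shows "h (Suc i) j \<le> Suc (h i j)"
proof -
  have "x ^ h i j * f j \<in> mpow R i" using x_power_f_mem_iff[OF j] by simp
  then have "x ^ h i j * f j * x \<in> mpow R (Suc i)" by (rule mpow_mult_mideal[OF _ x_mideal'])
  then have "x ^ Suc (h i j) * f j \<in> mpow R (Suc i)" by (simp add: ac_simps del: mpow.simps)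
  then show ?thesis using x_power_f_mem_iff[OF j] by blast
qed

lemma subdegree_x_power_f: "j < mult_e R \<Longrightarrow> subdegree (x ^ n * f j) = n * mult_e R + w_elt R j"
  using x f by (simp add: subdegree_power)

lemma h_bound:
  assumes j: "j < mult_e R"
  shows "i * mult_e R \<le> h i j * mult_e R + w_elt R j"
proof -
  have "fps_X ^ (i * mult_e R) dvd x ^ h i j * f j"
    by (rule mpow_dvd) (use x_power_f_mem_iff[OF j] in simp)
  then show ?thesis using subdegree_x_power_f[OF j] x f j by (simp add: fps_dvd_iff)
qed

lemma h_le: "j < mult_e R \<Longrightarrow> h i j \<le> i"
proof (induction i)
  case (Suc i)
  then show ?case using h_Suc[of j i] by simp
qed (simp add: h_0)

text \<open>i - \<open>h i j\<close> counts the zero steps before i. As m^i has order at least i e,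
  the count is bounded by w_j, hence eventually constant; a maximum over j makes the threshold
  uniform.\<close>

lemma ex_h_stable: "\<exists>N. \<forall>i\<ge>N. \<forall>j<mult_e R. h (Suc i) j = Suc (h i j)"
proof -
  have "\<exists>N. \<forall>i\<ge>N. h (Suc i) j = Suc (h i j)" if j: "j < mult_e R" for j
  proof -
    have "i - h i j \<le> w_elt R j" for i
    proof -
      have "(i - h i j) * mult_e R \<le> w_elt R j"
        using h_bound[OF j, of i] by (simp add: diff_mult_distrib)
      moreover have "(i - h i j) * 1 \<le> (i - h i j) * mult_e R" using mult_e_pos by (intro mult_le_mono) auto
      ultimately show ?thesis by linarith
    qed
    moreover have "i - h i j \<le> Suc i - h (Suc i) j" for i using h_Suc[OF j, of i] by simp
    ultimately obtain N where N: "\<forall>i\<ge>N. Suc i - h (Suc i) j = i - h i j"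
      using bounded_incseq_nat_stable[of "\<lambda>i. i - h i j" "w_elt R j"] by blast
    have "h (Suc i) j = Suc (h i j)" if "N \<le> i" for i
      using N[rule_format, OF that] h_le[OF j, of i] h_le[OF j, of "Suc i"] by linarith
    then show ?thesis by blast
  qed
  then obtain N where N: "\<And>j i. j < mult_e R \<Longrightarrow> N j \<le> i \<Longrightarrow> h (Suc i) j = Suc (h i j)" by metis
  have "N j \<le> Max (N ` {..<mult_e R})" if "j < mult_e R" for j using that by (intro Max_ge) auto
  then show ?thesis using N by (meson le_trans)
qed

text \<open>The order of g(x) is a multiple of e, so the j-th term has order congruent to j modulo
  e. Distinct terms have distinct orders and nothing cancels.\<close>

lemma subdegree_lincomb:
  assumes "lincomb G \<noteq> 0"
  obtains j where "j < mult_e R" "G j \<noteq> 0" "subdegree (lincomb G) = subdegree (G j) * mult_e R + w_elt R j"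
proof -
  define T where "T j = fps_compose (G j) x * f j" for j
  define v where "v j = subdegree (G j) * mult_e R + w_elt R j" for j
  let ?S = "{j. j < mult_e R \<and> G j \<noteq> 0}"
  have T: "T j \<noteq> 0" "subdegree (T j) = v j" if "j \<in> ?S" for j
    using that fps_compose_nonzero[OF _ x(2) x0, of "G j"] f x(3) by (auto simp: T_def v_def)
  have sum: "lincomb G = sum T ?S"
    unfolding lincomb_def T_def by (rule sum.mono_neutral_right) auto
  have "?S \<noteq> {}"
  proof
    assume "?S = {}"
    then have "lincomb G = 0" unfolding sum by (simp only: sum.empty)
    then show False using assms by simp
  qed
  then obtain j where j: "j \<in> ?S" "\<And>l. l \<in> ?S \<Longrightarrow> v j \<le> v l"
    using ex_has_least_nat[of "\<lambda>j. j \<in> ?S" _ v] by blast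
  have vmod: "v l mod mult_e R = l" if "l \<in> ?S" for l using that w_elt_mod[of l] by (simp add: v_def)
  have less: "v j < v l" if "l \<in> ?S" "l \<noteq> j" for l
    using j(2)[OF that(1)] vmod[OF that(1)] vmod[OF j(1)] that(2) by (metis le_neq_implies_less)
  have lin: "lincomb G = T j + sum T (?S - {j})" unfolding sum by (rule sum.remove) (use j in auto)
  have z: "fps_nth (T l) k = 0" if "l \<in> ?S - {j}" "k \<le> v j" for l k
    using less[of l] T[of l] that by (intro nth_less_subdegree_zero) auto
  have "subdegree (lincomb G) = v j"
  proof (rule subdegreeI)
    have "fps_nth (lincomb G) (v j) = fps_nth (T j) (v j)"
      unfolding lin by (simp add: fps_sum_nth z)
    also have "\<dots> \<noteq> 0" using T[OF j(1)] nth_subdegree_nonzero[of "T j"] by simp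
    finally show "fps_nth (lincomb G) (v j) \<noteq> 0" .
    fix k assume k: "k < v j"
    then have "fps_nth (T j) k = 0" using T[OF j(1)] by (intro nth_less_subdegree_zero) simp
    then show "fps_nth (lincomb G) k = 0" unfolding lin using k by (simp add: fps_sum_nth z)
  qed
  then show thesis using that j by (auto simp: v_def)
qed

lemma subdegree_mpow:
  assumes "a \<in> mpow R i" "a \<noteq> 0" "subdegree a mod mult_e R = j" "j < mult_e R"
  shows "h i j * mult_e R + w_elt R j \<le> subdegree a"
proof -
  obtain G where G: "a = lincomb G" "\<forall>j < mult_e R. fps_X ^ h i j dvd G j"
    using assms(1) unfolding mpow_lincomb by blast
  obtain l where l: "l < mult_e R" "G l \<noteq> 0" "subdegree a = subdegree (G l) * mult_e R + w_elt R l"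
    using subdegree_lincomb[of G] assms(2) G(1) by blast
  have "l = j" using l assms(3) w_elt_mod[of l] by simp
  moreover have "h i l \<le> subdegree (G l)" using G(2) l by (auto simp: fps_dvd_iff)
  ultimately show ?thesis using l(3) by simp
qed

section \<open>The invariants b_j and a_j in terms of \<open>h\<close>\<close>

lemma w_elt_mem_iff:
  assumes j: "j < mult_e R"
  shows "w_elt R j \<in> valset (mpow R i) \<longleftrightarrow> h i j = 0"
proof
  assume "w_elt R j \<in> valset (mpow R i)"
  then obtain a where "a \<in> mpow R i - {0}" "w_elt R j = subdegree a"
    unfolding valset_def by (rule imageE)
  then have a: "a \<in> mpow R i" "a \<noteq> 0" "subdegree a = w_elt R j" by simp_all
  then have "h i j * mult_e R + w_elt R j \<le> w_elt R j"
    using subdegree_mpow[of a i j] w_elt_mod[of j] j by simp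
  then show "h i j = 0" using mult_e_pos by simp
next
  assume "h i j = 0"
  then have "f j \<in> mpow R i" using x_power_f_mem_iff[OF j, of 0] by simp
  moreover have "f j \<noteq> 0" "w_elt R j = subdegree (f j)" using f j by simp_all
  ultimately show "w_elt R j \<in> valset (mpow R i)" unfolding valset_def by blast
qed

lemma fps_subalgebra_reduction:
  assumes N: "\<And>i j. N \<le> i \<Longrightarrow> j < mult_e R \<Longrightarrow> h (Suc i) j = Suc (h i j)"
  shows "fps_subalgebra_reduction R x N"
proof (unfold_locales, rule x_mideal', rule x(2), rule x(3), rule subsetI)
  fix i a assume i: "N \<le> i" and "a \<in> mpow R (Suc i)"
  then obtain G where G: "a = lincomb G" "\<forall>j < mult_e R. fps_X ^ h (Suc i) j dvd G j"
    unfolding mpow_lincomb by blast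
  have "\<exists>g. G j = g * fps_X \<and> fps_X ^ h i j dvd g" if j: "j < mult_e R" for j
  proof -
    have "fps_X ^ Suc (h i j) dvd G j" using G(2) j unfolding N[OF i j, symmetric] by blast
    then obtain g where "G j = fps_X ^ Suc (h i j) * g" by (elim dvdE)
    then show ?thesis by (intro exI[of _ "fps_X ^ h i j * g"]) (simp add: algebra_simps)
  qed
  then obtain g where g: "\<And>j. j < mult_e R \<Longrightarrow> G j = g j * fps_X \<and> fps_X ^ h i j dvd g j" by metis
  have "a = x * lincomb g" unfolding G(1) x_mult_lincomb using g by (simp add: lincomb_def)
  moreover have "lincomb g \<in> mpow R i" using g by (simp add: lincomb_mem_iff)
  ultimately show "a \<in> (*) x ` mpow R i" by blast
qed

text \<open>By R' = x^(-N) m^N, the values of R' are those of m^N lowered by N e. The least one in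
  the class of \<open>j\<close> comes from \<open>x ^ h N j * f j\<close>, so w'_j = w_j - (N - h N
  j) e.\<close>

lemma a_idx_eq:
  assumes N: "\<And>i j. N \<le> i \<Longrightarrow> j < mult_e R \<Longrightarrow> h (Suc i) j = Suc (h i j)" and j: "j < mult_e R"
  shows "a_idx R j = N - h N j"
proof -
  interpret red: fps_subalgebra_reduction R x N by (rule fps_subalgebra_reduction[OF N])
  let ?e = "mult_e R"
  let ?z = "x ^ h N j * f j"
  have z: "?z \<in> mpow R N" using x_power_f_mem_iff[OF j] by simp
  have z0: "?z \<noteq> 0" using x f j by simp
  \<comment> \<open>All of m^N has order at least N e, the order of \<open>x ^ N\<close>, so the
    quotient is still a power series.\<close>
  have "x ^ N dvd ?z"
    using mpow_dvd[OF z] z0 x by (simp add: fps_dvd_iff subdegree_power)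
  then obtain u where u: "?z = x ^ N * u" by (elim dvdE)
  have u0: "u \<noteq> 0" using z0 u by auto
  have su: "h N j * ?e + w_elt R j = N * ?e + subdegree u"
    using subdegree_x_power_f[OF j, of "h N j"] u u0 x by (simp add: subdegree_power)
  have "u \<in> blowup R" using z u by (simp add: red.blowup_iff)
  then have "subdegree u \<in> valset (blowup R)" using u0 by (auto simp: valset_def)
  moreover have "subdegree u mod ?e = j mod ?e"
  proof -
    have "subdegree u mod ?e = (N * ?e + subdegree u) mod ?e" by simp
    also have "\<dots> = w_elt R j mod ?e" by (simp flip: su)
    finally show ?thesis using w_elt_mod by simp
  qed
  moreover have "subdegree u \<le> n" if n: "n \<in> valset (blowup R) \<and> n mod ?e = j mod ?e" for n
  proof -
    obtain v where v: "v \<in> blowup R" "v \<noteq> 0" "n = subdegree v" using n by (auto simp: valset_def)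
    have "subdegree (x ^ N * v) = N * ?e + n" using v x by (simp add: subdegree_power)
    moreover have "h N j * ?e + w_elt R j \<le> subdegree (x ^ N * v)"
      using v x n j calculation by (intro subdegree_mpow) (auto simp: red.blowup_iff)
    ultimately show ?thesis using su by linarith
  qed
  ultimately have "w'_elt R j = subdegree u" unfolding w'_elt_def by (intro Least_equality) auto
  moreover have "w_elt R j - subdegree u = (N - h N j) * ?e"
    using su h_le[OF j, of N] by (simp add: diff_mult_distrib)
  ultimately show ?thesis using mult_e_pos by (simp add: a_idx_def)
qed

text \<open>Multiplication by \<open>x\<close> acts on every coordinate as multiplication by the
  variable, so regularity splits over j. A zero step after a unit step is detected by
  \<open>x ^ h i j * f j\<close>, which is outside m^(i+1) although its multiple by \<open>x\<close>
  lies in m^(i+2).\<close>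

lemma x_regular_iff:
  "(\<forall>i. \<forall>a \<in> mpow R i. x * a \<in> mpow R (Suc (Suc i)) \<longrightarrow> a \<in> mpow R (Suc i)) \<longleftrightarrow>
   (\<forall>j < mult_e R. \<forall>i. h (Suc i) j = Suc (h i j) \<longrightarrow> h (Suc (Suc i)) j = Suc (h (Suc i) j))"
  (is "?L \<longleftrightarrow> ?R")
proof
  assume L: ?L
  show ?R
  proof safe
    fix i j assume j: "j < mult_e R" and inc: "h (Suc i) j = Suc (h i j)"
    show "h (Suc (Suc i)) j = Suc (h (Suc i) j)"
    proof (rule ccontr)
      assume "h (Suc (Suc i)) j \<noteq> Suc (h (Suc i) j)"
      then have "h (Suc (Suc i)) j \<le> Suc (h i j)" using h_Suc[OF j, of "Suc i"] inc by simp
      then have "x ^ Suc (h i j) * f j \<in> mpow R (Suc (Suc i))" using x_power_f_mem_iff[OF j] by blast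
      then have "x * (x ^ h i j * f j) \<in> mpow R (Suc (Suc i))" by (simp add: mult.assoc del: mpow.simps)
      moreover have "x ^ h i j * f j \<in> mpow R i" using x_power_f_mem_iff[OF j] by simp
      ultimately have "x ^ h i j * f j \<in> mpow R (Suc i)" using L by blast
      then have "h (Suc i) j \<le> h i j" using x_power_f_mem_iff[OF j] by blast
      then show False using inc by simp
    qed
  qed
next
  assume R: ?R
  show ?L
  proof (intro allI ballI impI)
    fix i a assume a: "a \<in> mpow R i" and xa: "x * a \<in> mpow R (Suc (Suc i))"
    obtain G where G: "a = lincomb G" "\<forall>j < mult_e R. fps_X ^ h i j dvd G j"
      using a unfolding mpow_lincomb by blast
    have "fps_X ^ h (Suc i) j dvd G j" if j: "j < mult_e R" for j
    proof (cases "h (Suc i) j = Suc (h i j)")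
      case True
      then have "h (Suc (Suc i)) j = Suc (h (Suc i) j)" using R j by blast
      moreover have "fps_X ^ h (Suc (Suc i)) j dvd G j * fps_X"
        using xa j unfolding G(1) x_mult_lincomb lincomb_mem_iff by blast
      ultimately show ?thesis by simp
    next
      case False
      then have "h (Suc i) j = h i j" using h_mono[OF j, of i] h_Suc[OF j, of i] by simp
      then show ?thesis using G(2) j by simp
    qed
    then show "a \<in> mpow R (Suc i)" unfolding G(1) lincomb_mem_iff by blast
  qed
qed

theorem cohen_macaulay_iff_indices:
  "cohen_macaulay (gr_ring R) \<longleftrightarrow> (\<forall>j < mult_e R. a_idx R j = b_idx R j)"
proof -
  obtain N where N: "\<And>i j. N \<le> i \<Longrightarrow> j < mult_e R \<Longrightarrow> h (Suc i) j = Suc (h i j)"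
    using ex_h_stable by blast
  interpret red: fps_subalgebra_reduction R x N by (rule fps_subalgebra_reduction[OF N])
  have "a_idx R j = b_idx R j \<longleftrightarrow>
      (\<forall>i. h (Suc i) j = Suc (h i j) \<longrightarrow> h (Suc (Suc i)) j = Suc (h (Suc i) j))"
    if j: "j < mult_e R" for j
  proof -
    have "a_idx R j = N - h N j" by (rule a_idx_eq[OF _ j]) (rule N)
    then show ?thesis
      unfolding b_idx_def w_elt_mem_iff[OF j]
      using stable_iff_no_second_plateau[of "\<lambda>i. h i j" N] j h_0 h_mono h_Suc N by simp
  qed
  then show ?thesis unfolding red.cohen_macaulay_gr_iff x_regular_iff by blast
qed

end

theorem theorem2p2:
  fixes R :: "'a::field fps set"
  assumes constants: "\<forall>c. fps_const c \<in> R"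
    and add_closed: "\<forall>a \<in> R. \<forall>b \<in> R. a + b \<in> R"
    and mult_closed: "\<forall>a \<in> R. \<forall>b \<in> R. a * b \<in> R"
    and uminus_closed: "\<forall>a \<in> R. - a \<in> R"
    and local: "\<forall>r \<in> R. fps_nth r 0 \<noteq> 0 \<longrightarrow> inverse r \<in> R"
    and complete: "closed R"
    and conductor: "\<exists>y. y \<noteq> 0 \<and> (\<forall>f :: 'a fps. y * f \<in> R)"
    and BF: "BF_condition R"
  shows "cohen_macaulay (gr_ring R) \<longleftrightarrow> (\<forall>j < mult_e R. a_idx R j = b_idx R j)"
proof -
  interpret fps_subalgebra R
    by unfold_locales (use constants add_closed mult_closed uminus_closed conductor in auto)
  obtain x f where x: "x \<in> R" "x \<noteq> 0" "subdegree x = mult_e R"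
    and f: "\<And>j. j < mult_e R \<Longrightarrow> f j \<in> R \<and> f j \<noteq> 0 \<and> subdegree (f j) = w_elt R j"
    and ex_h: "\<forall>i. \<exists>h :: nat \<Rightarrow> nat.
         mpow R i = {(\<Sum>j < mult_e R. fps_compose (g j) x * x ^ h j * f j) | g. True} \<and>
         (\<forall>g. (\<Sum>j < mult_e R. fps_compose (g j) x * x ^ h j * f j) = 0
               \<longrightarrow> (\<forall>j < mult_e R. g j = 0))"
    using BF unfolding BF_condition_def by (elim exE conjE) blast
  from choice[OF ex_h] obtain h :: "nat \<Rightarrow> nat \<Rightarrow> nat" where h: "\<And>i.
         mpow R i = {(\<Sum>j < mult_e R. fps_compose (g j) x * x ^ h i j * f j) | g. True} \<and>
         (\<forall>g. (\<Sum>j < mult_e R. fps_compose (g j) x * x ^ h i j * f j) = 0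
               \<longrightarrow> (\<forall>j < mult_e R. g j = 0))"
    by blast
  interpret fps_BF R x f h
    by unfold_locales (use x f h in blast)+
  show ?thesis by (rule cohen_macaulay_iff_indices)
qed

end
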